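(* Let $n\ge1$, $N=2^n$ and $M=4$. For a tuple $(\alpha,\beta,\gamma,\delta,r,s,c)\in\mathbb{Z}_N^4\times\mathbb{Z}_N^2\times\mathbb{Z}_4$ with $Z=\begin{pmatrix}\alpha&\beta\\ \gamma&\delta\end{pmatrix}\in\mathrm{GL}_2(\mathbb{Z}_N)$, let $G$ be the group defined by the presentation $$G=\left\langle a,b,t,z \;\middle|\; \begin{array}{l} a^N=b^N=t^2=z^4=1,\ [a,b]=1,\\ a^t=b,\ b^t=a,\\ a^z=a^{\alpha}b^{\beta},\ b^z=a^{\gamma}b^{\delta},\\ t^z=t\,z^{2c}a^{r}b^{s}\end{array}\right\rangle ,$$ and put $H=\langle a,b,t\rangle$, $K=\langle z\rangle$, $B=\langle a,b\rangle$ (subgroups of $G$), $J=\begin{pmatrix}0&1\\1&0\end{pmatrix}$ and $k:=1-2c$. Then $G=HK$ is an exact product with $H\cong\mathrm{W}_{2^n}$, $K\cong C_4$ and $B$ normal in $G$ if and only if the following conditions hold: 1. $A_4\alpha+B_4\equiv1,\ A_4\beta\equiv0,\ A_4\gamma\equiv0,\ A_4\delta+B_4\equiv1\pmod N$; 2. $A_k\alpha+B_k\equiv\delta,\ A_k\beta\equiv\gamma,\ A_k\gamma\equiv\beta,\ A_k\delta+B_k\equiv\alpha\pmod N$; 3. $(r,s)\,Z^{-2c}\bigl(S_k(Z^k)+J\bigr)\equiv(0,0)\pmod N$; 4. $(r,s)\,Z^{-2c}\,S_4(Z^k)\equiv(0,0)\pmod N$. Moreover, the congruence $(1-2c)^2\equiv1\pmod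 4$ holds automatically.
   Context: All groups are finite; $g^h=h^{-1}gh$, $[g,h]=g^{-1}h^{-1}gh$; $\mathbb{Z}_N=\mathbb{Z}/N\mathbb{Z}$. The wreathed $2$-group is $\mathrm{W}_{2^n}=C_{2^n}\wr C_2=\langle a,b,t\mid a^N=b^N=t^2=1,\ [a,b]=1,\ a^t=b,\ b^t=a\rangle$, of order $2N^2$, with base $\langle a\rangle\times\langle b\rangle\cong(\mathbb{Z}_N)^2$. A product $G=HK$ of subgroups is exact if $H\cap K=\{1\}$. $Z$ acts on row exponent vectors by right multiplication: $(a^ib^j)^z$ corresponds to $(i,j)Z=(i\alpha+j\gamma,\ i\beta+j\delta)$. Put $\tau=\alpha+\delta$ and $\nu=\alpha\delta-\beta\gamma$. The sequences $(A_j)_{j\ge0}$, $(B_j)_{j\ge0}$ (taken modulo $N$) are defined by $A_0=0$, $A_1=1$, $A_{j+1}=\tau A_j-\nu A_{j-1}$ for $j\ge 1$, and $B_0=1$, $B_j=-\nu A_{j-1}$ for $j\ge1$; thus $Z^j=A_jZ+B_jI$ for all $j\ge0$. For a positive integer $l$, $S_l(X):=I+X+\cdots+X^{l-1}$. In $A_k$, $B_k$, $Z^k$ and $S_k(Z^k)$ the integer $k$ is the representative of $1-2c$ modulo $4$ in $\{1,3\}$; condition 1 says $Z^4=I$, so $Z^{-2c}$ is well defined for $c\in\mathbb{Z}_4$. *)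

theory Defs
  imports
    "HOL-Analysis.Cartesian_Space"
    "HOL-Number_Theory.Cong"
    "HOL-Algebra.Coset"
    "HOL-Algebra.Generated_Groups"
    "HOL-Algebra.Elementary_Groups"
begin

text \<open>A word is a list of letters; \<open>(x, True)\<close> stands for the generator \<open>x\<close> and \<open>(x, False)\<close>
  for its formal inverse.\<close>

type_synonym 'x gword = "('x \<times> bool) list"

definition gletter :: "'x \<Rightarrow> 'x gword" where
  "gletter x = [(x, True)]"

definition ginv :: "'x gword \<Rightarrow> 'x gword" where
  "ginv w = rev (map (\<lambda>(x, e). (x, \<not> e)) w)"

definition gpow :: "'x gword \<Rightarrow> nat \<Rightarrow> 'x gword" where
  "gpow w m = concat (replicate m w)"

definition gconj :: "'x gword \<Rightarrow> 'x gword \<Rightarrow> 'x gword" where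
  "gconj g h = ginv h @ g @ h"

definition gcomm :: "'x gword \<Rightarrow> 'x gword \<Rightarrow> 'x gword" where
  "gcomm g h = ginv g @ ginv h @ g @ h"

text \<open>A pair \<open>(u, v)\<close> of words in \<open>R\<close> is the relation \<open>u = v\<close>. The following is the least
  congruence on words that contains \<open>R\<close> and makes \<open>(x, True)\<close> and \<open>(x, False)\<close> mutually
  inverse, so that the quotient is the group \<open>\<langle>X | R\<rangle>\<close>, with generating set \<open>X\<close> the whole
  type \<open>'x\<close>.\<close>

inductive pres_eq :: "('x gword \<times> 'x gword) set \<Rightarrow> 'x gword \<Rightarrow> 'x gword \<Rightarrow> bool"
  for R where
  relator: "(u, v) \<in> R \<Longrightarrow> pres_eq R u v"
| cancel: "pres_eq R [(x, e), (x, \<not> e)] []"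
| refl: "pres_eq R u u"
| sym: "pres_eq R u v \<Longrightarrow> pres_eq R v u"
| trans: "pres_eq R u v \<Longrightarrow> pres_eq R v w \<Longrightarrow> pres_eq R u w"
| append: "pres_eq R u u' \<Longrightarrow> pres_eq R v v' \<Longrightarrow> pres_eq R (u @ v) (u' @ v')"

definition pres_class :: "('x gword \<times> 'x gword) set \<Rightarrow> 'x gword \<Rightarrow> 'x gword set" where
  "pres_class R u = {v. pres_eq R u v}"

definition presented_group :: "('x gword \<times> 'x gword) set \<Rightarrow> 'x gword set monoid" where
  "presented_group R =
    \<lparr>carrier = range (pres_class R),
     monoid.mult = (\<lambda>X Y. \<Union>u\<in>X. \<Union>v\<in>Y. pres_class R (u @ v)),
     one = pres_class R []\<rparr>"

definition pres_gen :: "('x gword \<times> 'x gword) set \<Rightarrow> 'x \<Rightarrow> 'x gword set" where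
  "pres_gen R x = pres_class R (gletter x)"

lemma pres_class_eq_iff: "pres_class R u = pres_class R v \<longleftrightarrow> pres_eq R u v"
  unfolding pres_class_def by (blast intro: pres_eq.refl pres_eq.sym pres_eq.trans)

lemma presented_group_mult:
  "pres_class R u \<otimes>\<^bsub>presented_group R\<^esub> pres_class R v = pres_class R (u @ v)"
proof -
  have eq: "pres_class R (u' @ v') = pres_class R (u @ v)"
    if "u' \<in> pres_class R u" "v' \<in> pres_class R v" for u' v'
  proof -
    have "pres_eq R u u'" "pres_eq R v v'"
      using that by (simp_all add: pres_class_def)
    then have "pres_eq R (u' @ v') (u @ v)"
      by (intro pres_eq.append pres_eq.sym[of R u] pres_eq.sym[of R v])
    then show ?thesis by (simp only: pres_class_eq_iff)
  qed
  have mem: "u \<in> pres_class R u" "v \<in> pres_class R v"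
    by (simp_all add: pres_class_def pres_eq.refl)
  have "(\<Union>u'\<in>pres_class R u. \<Union>v'\<in>pres_class R v. pres_class R (u' @ v'))
      = (\<Union>u'\<in>pres_class R u. \<Union>v'\<in>pres_class R v. pres_class R (u @ v))"
    by (intro SUP_cong HOL.refl eq)
  also have "\<dots> = pres_class R (u @ v)"
    using mem by blast
  finally show ?thesis
    by (simp add: presented_group_def)
qed

lemma pres_eq_ginv: "pres_eq R (ginv w @ w) []"
proof (induction w)
  case Nil
  then show ?case by (simp add: ginv_def pres_eq.refl)
next
  case (Cons p w)
  obtain x e where p: "p = (x, e)" by (cases p)
  have "pres_eq R ((ginv w @ [(x, \<not> e), (x, e)]) @ w) ((ginv w @ []) @ w)"
    using pres_eq.cancel[of R x "\<not> e"]
    by (intro pres_eq.append pres_eq.refl) simp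
  then have "pres_eq R (ginv (p # w) @ p # w) (ginv w @ w)"
    by (simp add: p ginv_def)
  then show ?case
    using Cons.IH by (rule pres_eq.trans)
qed

lemma group_presented_group: "group (presented_group R)"
proof (rule groupI)
  let ?G = "presented_group R"
  have carr: "X \<in> carrier ?G \<longleftrightarrow> (\<exists>u. X = pres_class R u)" for X
    by (auto simp: presented_group_def)
  have one: "\<one>\<^bsub>?G\<^esub> = pres_class R []"
    by (simp add: presented_group_def)
  show "X \<otimes>\<^bsub>?G\<^esub> Y \<in> carrier ?G" if "X \<in> carrier ?G" "Y \<in> carrier ?G" for X Y
    using that unfolding carr by (elim exE) (simp only: presented_group_mult, blast)
  show "\<one>\<^bsub>?G\<^esub> \<in> carrier ?G"
    using one carr by blast
  show "X \<otimes>\<^bsub>?G\<^esub> Y \<otimes>\<^bsub>?G\<^esub> V = X \<otimes>\<^bsub>?G\<^esub> (Y \<otimes>\<^bsub>?G\<^esub> V)"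
    if "X \<in> carrier ?G" "Y \<in> carrier ?G" "V \<in> carrier ?G" for X Y V
    using that unfolding carr by (elim exE) (simp only: presented_group_mult append_assoc)
  show "\<one>\<^bsub>?G\<^esub> \<otimes>\<^bsub>?G\<^esub> X = X" if "X \<in> carrier ?G" for X
    using that unfolding carr one by (elim exE) (simp only: presented_group_mult append_Nil)
  show "\<exists>Y\<in>carrier ?G. Y \<otimes>\<^bsub>?G\<^esub> X = \<one>\<^bsub>?G\<^esub>" if X: "X \<in> carrier ?G" for X
  proof -
    obtain u where u: "X = pres_class R u" using X carr by blast
    have "pres_class R (ginv u) \<otimes>\<^bsub>?G\<^esub> X = \<one>\<^bsub>?G\<^esub>"
      unfolding u one presented_group_mult pres_class_eq_iff by (rule pres_eq_ginv)
    then show ?thesis using carr by blast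
  qed
qed

datatype wreath_gen = Wa | Wb | Wt

definition wreathed :: "nat \<Rightarrow> wreath_gen gword set monoid" where
  "wreathed n =
    (let N = 2 ^ n; a = gletter Wa; b = gletter Wb; t = gletter Wt in
     presented_group
      {(gpow a N, []), (gpow b N, []), (gpow t 2, []),
       (gcomm a b, []),
       (gconj a t, b), (gconj b t, a)})"

datatype ext_gen = Ga | Gb | Gt | Gz

text \<open>Elements of \<open>\<int>\<^sub>N\<close> and \<open>\<int>\<^sub>4\<close> are represented by integers in \<open>{0..<N}\<close> and \<open>{0..<4}\<close>;
  on such representatives \<open>nat\<close> does not truncate.\<close>

definition ext_rels ::
  "nat \<Rightarrow> int \<Rightarrow> int \<Rightarrow> int \<Rightarrow> int \<Rightarrow> int \<Rightarrow> int \<Rightarrow> int \<Rightarrow> (ext_gen gword \<times> ext_gen gword) set" where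
  "ext_rels n \<alpha> \<beta> \<gamma> \<delta> r s c =
    (let N = 2 ^ n; a = gletter Ga; b = gletter Gb; t = gletter Gt; z = gletter Gz in
      {(gpow a N, []), (gpow b N, []), (gpow t 2, []), (gpow z 4, []),
       (gcomm a b, []),
       (gconj a t, b), (gconj b t, a),
       (gconj a z, gpow a (nat \<alpha>) @ gpow b (nat \<beta>)),
       (gconj b z, gpow a (nat \<gamma>) @ gpow b (nat \<delta>)),
       (gconj t z, t @ gpow z (nat (2 * c)) @ gpow a (nat r) @ gpow b (nat s))})"

definition exact_product :: "('g, 'm) monoid_scheme \<Rightarrow> 'g set \<Rightarrow> 'g set \<Rightarrow> bool" where
  "exact_product G H K \<longleftrightarrow>
    subgroup H G \<and> subgroup K G \<and> carrier G = H <#>\<^bsub>G\<^esub> K \<and> H \<inter> K = {\<one>\<^bsub>G\<^esub>}"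

definition mat_cong :: "int \<Rightarrow> int^'n^'m \<Rightarrow> int^'n^'m \<Rightarrow> bool" where
  "mat_cong m X Y \<longleftrightarrow> (\<forall>i j. [X $ i $ j = Y $ i $ j] (mod m))"

definition vec_cong :: "int \<Rightarrow> int^'n \<Rightarrow> int^'n \<Rightarrow> bool" where
  "vec_cong m v w \<longleftrightarrow> (\<forall>i. [v $ i = w $ i] (mod m))"

definition is_mat_inv_mod :: "int \<Rightarrow> int^'n^'n \<Rightarrow> int^'n^'n \<Rightarrow> bool" where
  "is_mat_inv_mod m X Y \<longleftrightarrow> mat_cong m (X ** Y) (mat 1) \<and> mat_cong m (Y ** X) (mat 1)"

definition invertible_mod :: "int \<Rightarrow> int^'n^'n \<Rightarrow> bool" where
  "invertible_mod m X \<longleftrightarrow> (\<exists>Y. is_mat_inv_mod m X Y)"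

text \<open>A representative of the inverse; it is determined only modulo \<open>m\<close>, and is meaningful only
  if \<open>invertible_mod m X\<close>.\<close>

definition mat_inv_mod :: "int \<Rightarrow> int^'n^'n \<Rightarrow> int^'n^'n" where
  "mat_inv_mod m X = (SOME Y. is_mat_inv_mod m X Y)"

text \<open>The library's \<open>^\<close> on vectors and matrices is the entrywise power; this is the power with
  respect to \<open>**\<close>.\<close>

primrec mat_pow :: "int^'n^'n \<Rightarrow> nat \<Rightarrow> int^'n^'n" where
  "mat_pow X 0 = mat 1"
| "mat_pow X (Suc i) = mat_pow X i ** X"

definition mat_powi_mod :: "int \<Rightarrow> int^'n^'n \<Rightarrow> int \<Rightarrow> int^'n^'n" where
  "mat_powi_mod m X e =
    (if e \<ge> 0 then mat_pow X (nat e) else mat_pow (mat_inv_mod m X) (nat (- e)))"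

definition mat_geom :: "nat \<Rightarrow> int^'n^'n \<Rightarrow> int^'n^'n" where
  "mat_geom l X = (\<Sum>i<l. mat_pow X i)"

definition mat2 :: "int \<Rightarrow> int \<Rightarrow> int \<Rightarrow> int \<Rightarrow> int^2^2" where
  "mat2 p q u v = vector [vector [p, q], vector [u, v]]"

fun seqA :: "int \<Rightarrow> int \<Rightarrow> nat \<Rightarrow> int" where
  "seqA \<tau> \<nu> 0 = 0"
| "seqA \<tau> \<nu> (Suc 0) = 1"
| "seqA \<tau> \<nu> (Suc (Suc j)) = \<tau> * seqA \<tau> \<nu> (Suc j) - \<nu> * seqA \<tau> \<nu> j"

fun seqB :: "int \<Rightarrow> int \<Rightarrow> nat \<Rightarrow> int" where
  "seqB \<tau> \<nu> 0 = 1"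
| "seqB \<tau> \<nu> (Suc j) = - \<nu> * seqA \<tau> \<nu> j"

text \<open>\<open>Z\<^sup>j = A\<^sub>j Z + B\<^sub>j I\<close>, entrywise.\<close>

lemma mat_pow_mat2:
  fixes p q u v :: int
  defines "A \<equiv> seqA (p + v) (p * v - q * u)" and "B \<equiv> seqB (p + v) (p * v - q * u)"
  shows "mat_pow (mat2 p q u v) j = mat2 (A j * p + B j) (A j * q) (A j * u) (A j * v + B j)"
proof (induction j)
  case 0
  then show ?case
    by (simp add: A_def B_def mat2_def mat_def vec_eq_iff forall_2)
next
  case (Suc j)
  have "A (Suc j) = (p + v) * A j + B j"
    by (cases j) (simp_all add: A_def B_def algebra_simps)
  moreover have "B (Suc j) = - (p * v - q * u) * A j"
    by (simp add: A_def B_def)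
  ultimately show ?case
    unfolding mat_pow.simps Suc.IH
    by (simp add: mat2_def matrix_matrix_mult_def vec_eq_iff forall_2 sum_2 algebra_simps)
qed

end

theory Submission
  imports Defs
begin

text \<open>
  Write \<open>\<phi>(v) = a\<^sup>i b\<^sup>j\<close> for \<open>v = (i, j)\<close>, \<open>d = 2c\<close>, and let \<open>u\<close> be the vector with
  \<open>u Z\<^sup>d = (r, s)\<close>. In any group that satisfies the relations, conjugation by \<open>z\<close> and by \<open>t\<close> acts on
  \<open>\<phi>(v)\<close> as \<open>v \<mapsto> v Z\<close> and \<open>v \<mapsto> v J\<close>, and the last relation can be solved for the conjugate of
  \<open>z\<close> by \<open>t\<close>: it says \<open>z t = t z\<^sup>k \<phi>(-u)\<close> (lemma \<open>z_t\<close>). So the presentation attempts to build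
  first the semidirect product of \<open>\<int>\<^sub>N\<^sup>2\<close> by \<open>C\<^sub>4\<close>, and then its extension by an involution \<open>t\<close>
  acting as \<open>v \<mapsto> v J\<close>, \<open>z \<mapsto> z\<^sup>k \<phi>(-u)\<close>. The four conditions are exactly what this needs:
  \<^item> \<open>Z\<^sup>4 = I\<close>, so that \<open>C\<^sub>4\<close> acts;
  \<^item> \<open>J Z J = Z\<^sup>k\<close>, so that the map respects the action of \<open>z\<close> on \<open>\<int>\<^sub>N\<^sup>2\<close>;
  \<^item> \<open>u (S\<^sub>k(Z\<^sup>k) + J) = 0\<close>, so that applying it twice gives back \<open>z\<close>;
  \<^item> \<open>u S\<^sub>4(Z\<^sup>k) = 0\<close>, so that the image of \<open>z\<close> has fourth power \<open>1\<close>.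

  Necessity (lemma \<open>faithful_imp_compatible\<close>). If \<open>H\<close> is isomorphic to the wreathed group then it
  has \<open>2N\<^sup>2\<close> elements. Every element of \<open>H\<close> is \<open>\<phi>(v) t\<^sup>e\<close>, with \<open>2N\<^sup>2\<close> choices for the residues
  of \<open>v\<close> and \<open>e\<close>, so \<open>\<phi>(v)\<close> determines \<open>v\<close> modulo \<open>N\<close>. Evaluating \<open>\<phi>(v)\<close> conjugated by \<open>z\<^sup>4\<close>,
  \<open>\<phi>(v)\<close> conjugated by \<open>z t\<close>, \<open>z t t\<close> and \<open>z\<^sup>4 t\<close> in two ways gives the four conditions as
  equations between values of \<open>\<phi>\<close>.

  Sufficiency. Every element of \<open>G\<close> has a normal form \<open>z\<^sup>i \<phi>(v) t\<^sup>e\<close>. Under the conditions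
  the normal forms are distinct: rather than constructing the extension as a group and
  verifying its axioms, one lets the generators act on triples \<open>(i, v, e)\<close> as right
  multiplication by a generator would act on \<open>z\<^sup>i \<phi>(v) t\<^sup>e\<close>. Checking the relations for this
  action (lemma \<open>word_run_ext_rels\<close>) shows that equal words move \<open>(0, 0, False)\<close> to congruent
  triples. Exactness of the product, the order of \<open>z\<close> and the structure of \<open>H\<close> are then read
  off from normal forms; an epimorphism from the wreathed group onto \<open>H\<close> is injective because
  both have \<open>2N\<^sup>2\<close> elements.

  That the wreathed group has \<open>2N\<^sup>2\<close> elements and not fewer (lemma \<open>card_wreathed\<close>), as necessity
  requires, follows from the special case \<open>Z = I\<close>, \<open>r = s = c = 0\<close> of the same action, in which
  the extension is the direct product of the wreathed group with \<open>C\<^sub>4\<close>.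
\<close>

section \<open>Words in groups and groups given by generators and relations\<close>

definition word_val :: "('g, 'm) monoid_scheme \<Rightarrow> ('x \<Rightarrow> 'g) \<Rightarrow> 'x gword \<Rightarrow> 'g" where
  "word_val G f w =
    foldr (\<lambda>(x, e) y. (if e then f x else inv\<^bsub>G\<^esub> (f x)) \<otimes>\<^bsub>G\<^esub> y) w \<one>\<^bsub>G\<^esub>"

context group
begin

context
  fixes f :: "'x \<Rightarrow> 'a"
  assumes f: "\<And>x. f x \<in> carrier G"
begin

lemma word_val_closed: "word_val G f w \<in> carrier G"
  by (induction w) (auto simp: word_val_def f)

lemma word_val_append: "word_val G f (u @ v) = word_val G f u \<otimes> word_val G f v"
proof (induction u)
  case Nil
  then show ?case using word_val_closed[of v] by (simp add: word_val_def)
next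
  case (Cons p u)
  then show ?case
    using word_val_closed[of u] word_val_closed[of v] f
    by (cases p) (simp add: word_val_def m_assoc)
qed

lemma word_val_Nil: "word_val G f [] = \<one>"
  by (simp add: word_val_def)

lemma word_val_gletter: "word_val G f (gletter x) = f x"
  by (simp add: word_val_def gletter_def f)

lemma word_val_gpow: "word_val G f (gpow w m) = word_val G f w [^] m"
proof (induction m)
  case (Suc m)
  then show ?case
    using nat_pow_Suc2[OF word_val_closed] by (simp add: gpow_def word_val_append)
qed (simp add: gpow_def word_val_Nil)

lemma word_val_ginv: "word_val G f (ginv w) = inv (word_val G f w)"
proof (induction w)
  case Nil
  then show ?case by (simp add: ginv_def word_val_def)
next
  case (Cons p w)
  obtain x e where p: "p = (x, e)" by (cases p)
  have "word_val G f (ginv (p # w)) = word_val G f (ginv w) \<otimes> word_val G f [(x, \<not> e)]"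
    by (simp add: p ginv_def word_val_append)
  also have "word_val G f [(x, \<not> e)] = inv (word_val G f [(x, e)])"
    by (simp add: word_val_def f)
  also have "word_val G f (ginv w) = inv (word_val G f w)"
    by (rule Cons.IH)
  also have "inv (word_val G f w) \<otimes> inv (word_val G f [(x, e)])
      = inv (word_val G f ([(x, e)] @ w))"
    unfolding word_val_append by (rule inv_mult_group[symmetric]) (rule word_val_closed)+
  finally show ?case by (simp add: p)
qed

lemma word_val_gconj:
  "word_val G f (gconj g h) = inv (word_val G f h) \<otimes> word_val G f g \<otimes> word_val G f h"
  by (simp add: gconj_def word_val_append word_val_ginv word_val_closed m_assoc)

lemma word_val_gcomm:
  "word_val G f (gcomm g h) = inv (word_val G f g) \<otimes> inv (word_val G f h)
     \<otimes> word_val G f g \<otimes> word_val G f h"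
  by (simp add: gcomm_def word_val_append word_val_ginv word_val_closed m_assoc)

lemmas word_val_simps = word_val_append word_val_Nil word_val_gletter word_val_gpow
  word_val_gconj word_val_gcomm

lemma word_val_pres_eq:
  assumes "pres_eq R u v" and rels: "\<And>p q. (p, q) \<in> R \<Longrightarrow> word_val G f p = word_val G f q"
  shows "word_val G f u = word_val G f v"
  using assms(1)
proof induction
  case (cancel x e)
  show ?case using f by (cases e) (simp_all add: word_val_def)
qed (simp_all add: rels word_val_append)

text \<open>The universal property of a presentation. A word is chosen from each class; by the previous
  lemma its value does not depend on the choice.\<close>

lemma presented_group_hom:
  assumes rels: "\<And>p q. (p, q) \<in> R \<Longrightarrow> word_val G f p = word_val G f q"
  obtains h where "h \<in> hom (presented_group R) G"
    and "\<And>u. h (pres_class R u) = word_val G f u"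
proof
  define h where "h X = word_val G f (SOME u. u \<in> X)" for X
  show h_class: "h (pres_class R u) = word_val G f u" for u
  proof -
    have "(SOME v. v \<in> pres_class R u) \<in> pres_class R u"
      by (rule someI[of _ u]) (simp add: pres_class_def pres_eq.refl)
    then show ?thesis
      unfolding h_def pres_class_def using word_val_pres_eq[OF _ rels] by fastforce
  qed
  show "h \<in> hom (presented_group R) G"
  proof (rule homI)
    fix X Y
    assume "X \<in> carrier (presented_group R)" "Y \<in> carrier (presented_group R)"
    then obtain u v where "X = pres_class R u" "Y = pres_class R v"
      by (auto simp: presented_group_def)
    then show "h (X \<otimes>\<^bsub>presented_group R\<^esub> Y) = h X \<otimes> h Y"
      by (simp add: presented_group_mult h_class word_val_append)
  qed (auto simp: presented_group_def h_class word_val_closed)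
qed

end

end

lemma pres_class_in_carrier: "pres_class R u \<in> carrier (presented_group R)"
  by (simp add: presented_group_def)

lemma pres_gen_in_carrier: "pres_gen R x \<in> carrier (presented_group R)"
  by (simp add: pres_gen_def pres_class_in_carrier)

lemma one_presented_group: "\<one>\<^bsub>presented_group R\<^esub> = pres_class R []"
  by (simp add: presented_group_def)

lemma inv_pres_gen: "inv\<^bsub>presented_group R\<^esub> (pres_gen R x) = pres_class R [(x, False)]"
proof -
  interpret group "presented_group R" by (rule group_presented_group)
  have "pres_class R [(x, False)] \<otimes>\<^bsub>presented_group R\<^esub> pres_gen R x = \<one>\<^bsub>presented_group R\<^esub>"
    using pres_eq.cancel[of R x False]
    by (simp add: pres_gen_def gletter_def presented_group_mult one_presented_group
        pres_class_eq_iff)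
  then show ?thesis
    using inv_equality pres_class_in_carrier pres_gen_in_carrier by metis
qed

lemma carrier_presented_group_range: "carrier (presented_group R) = range (pres_class R)"
  by (simp add: presented_group_def)

lemma word_val_Cons:
  "word_val G f ((x, e) # w) = (if e then f x else inv\<^bsub>G\<^esub> (f x)) \<otimes>\<^bsub>G\<^esub> word_val G f w"
  by (simp add: word_val_def)

text \<open>Evaluated at the generators of the presented group itself, a word gives its own class. This
  turns each relation of the presentation into an equation between group elements.\<close>

lemma word_val_pres_gen: "word_val (presented_group R) (pres_gen R) w = pres_class R w"
proof (induction w)
  case Nil
  then show ?case by (simp add: word_val_def one_presented_group)
next
  case (Cons p w)
  obtain x e where p: "p = (x, e)" by (cases p)
  have "(if e then pres_gen R x else inv\<^bsub>presented_group R\<^esub> (pres_gen R x)) = pres_class R [(x, e)]"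
    unfolding inv_pres_gen by (simp add: pres_gen_def gletter_def)
  then show ?case
    unfolding p word_val_Cons Cons.IH by (simp add: presented_group_mult)
qed

lemma presented_group_relator:
  assumes "(u, v) \<in> R"
  shows "word_val (presented_group R) (pres_gen R) u = word_val (presented_group R) (pres_gen R) v"
  using pres_eq.relator[OF assms] by (simp add: word_val_pres_gen pres_class_eq_iff)

lemma (in group) word_val_in_generate: "word_val G f w \<in> generate G (range f)"
proof (induction w)
  case Nil
  then show ?case by (simp add: word_val_def generate.one)
next
  case (Cons p w)
  then show ?case
    by (cases p) (auto simp: word_val_def intro: generate.intros)
qed

lemma carrier_presented_group:
  "carrier (presented_group R) = generate (presented_group R) (range (pres_gen R))"
proof -
  interpret group "presented_group R" by (rule group_presented_group)
  have "X \<in> generate (presented_group R) (range (pres_gen R))"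
    if "X \<in> carrier (presented_group R)" for X
    using that word_val_in_generate[of "pres_gen R"]
    unfolding carrier_presented_group_range word_val_pres_gen by blast
  moreover have "generate (presented_group R) (range (pres_gen R)) \<subseteq> carrier (presented_group R)"
    by (intro generate_incl) (auto simp: pres_gen_in_carrier)
  ultimately show ?thesis by blast
qed

text \<open>Letters may also act on an arbitrary set of states, and an equivalence on the states may take
  the place of equality. This allows integer vectors to be used as states without first reducing
  them modulo \<open>N\<close>. The word is read from left to right, so that the action is a right
  action.\<close>

definition word_run :: "('x \<times> bool \<Rightarrow> 's \<Rightarrow> 's) \<Rightarrow> 'x gword \<Rightarrow> 's \<Rightarrow> 's" where
  "word_run act w s = fold act w s"

lemma word_run_append: "word_run act (u @ v) s = word_run act v (word_run act u s)"
  by (simp add: word_run_def)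

lemma word_run_Nil: "word_run act [] s = s"
  by (simp add: word_run_def)

lemma word_run_gpow: "word_run act (gpow w m) = word_run act w ^^ m"
proof (induction m)
  case (Suc m)
  then show ?case
    by (simp add: gpow_def word_run_append fun_eq_iff del: funpow.simps)
      (simp add: funpow_swap1 word_run_append)
qed (simp add: gpow_def fun_eq_iff word_run_Nil)

lemma pres_eq_word_run:
  assumes "pres_eq R u v"
    and "equivp E"
    and resp: "\<And>l s s'. E s s' \<Longrightarrow> E (act l s) (act l s')"
    and rels: "\<And>p q s. (p, q) \<in> R \<Longrightarrow> E (word_run act p s) (word_run act q s)"
    and cancel: "\<And>x e s. E (act (x, \<not> e) (act (x, e) s)) s"
  shows "E (word_run act u s) (word_run act v s)"
proof -
  have run_resp: "E (word_run act w s) (word_run act w s')" if "E s s'" for w s s'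
    using that by (induction w arbitrary: s s') (simp_all add: word_run_def resp)
  show ?thesis
    using assms(1)
  proof (induction arbitrary: s)
    case (append u u' v v')
    then show ?case
      using run_resp equivp_transp[OF \<open>equivp E\<close>] by (simp add: word_run_append) blast
  next
    case (sym u v)
    then show ?case using equivp_symp[OF \<open>equivp E\<close>] by blast
  next
    case (trans u v w)
    then show ?case using equivp_transp[OF \<open>equivp E\<close>] by blast
  next
    case (cancel x e)
    then show ?case using assms(5) by (simp add: word_run_def)
  qed (simp_all add: rels equivp_reflp[OF \<open>equivp E\<close>])
qed

section \<open>Congruences between integer vectors and matrices\<close>

lemma vec_cong_refl [simp]: "vec_cong m v v"
  by (simp add: vec_cong_def)

lemma vec_cong_sym: "vec_cong m v w \<Longrightarrow> vec_cong m w v"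
  by (simp add: vec_cong_def cong_sym_eq)

lemma vec_cong_trans [trans]: "vec_cong m u v \<Longrightarrow> vec_cong m v w \<Longrightarrow> vec_cong m u w"
  unfolding vec_cong_def by (meson cong_trans)

lemma vec_cong_add: "vec_cong m v v' \<Longrightarrow> vec_cong m w w' \<Longrightarrow> vec_cong m (v + w) (v' + w')"
  by (simp add: vec_cong_def cong_add)

lemma vec_cong_diff: "vec_cong m v v' \<Longrightarrow> vec_cong m w w' \<Longrightarrow> vec_cong m (v - w) (v' - w')"
  by (simp add: vec_cong_def cong_diff)

lemma vec_cong_minus: "vec_cong m v v' \<Longrightarrow> vec_cong m (- v) (- v')"
  using vec_cong_diff[of m 0 0 v v'] by simp

lemma vec_cong_diff_0: "vec_cong m (v - w) 0 \<longleftrightarrow> vec_cong m v w"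
  by (simp add: vec_cong_def cong_diff_iff_cong_0)

lemma vec_cong_vector_matrix_mult:
  "vec_cong m v w \<Longrightarrow> vec_cong m (v v* X) (w v* X)"
  by (simp add: vec_cong_def vector_matrix_mult_def cong_sum cong_mult)

lemma mat_cong_imp_vec_cong: "mat_cong m X Y \<Longrightarrow> vec_cong m (v v* X) (v v* Y)"
  by (simp add: vec_cong_def mat_cong_def vector_matrix_mult_def cong_sum cong_mult)

lemma vector_matrix_mult_minus: "(- v) v* X = - (v v* (X :: int^'n^'m))"
  using vector_matrix_mult_diff_distrib[of 0 v X] by simp

lemma mat_congI:
  fixes X Y :: "int^2^2"
  assumes "\<And>v. vec_cong m (v v* X) (v v* Y)"
  shows "mat_cong m X Y"
  using assms[of "vector [1, 0]"] assms[of "vector [0, 1]"]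
  by (simp add: vec_cong_def mat_cong_def vector_matrix_mult_def forall_2 sum_2)

lemma mat_cong_refl [simp]: "mat_cong m X X"
  by (simp add: mat_cong_def)

lemma mat_cong_trans [trans]: "mat_cong m X Y \<Longrightarrow> mat_cong m Y W \<Longrightarrow> mat_cong m X W"
  unfolding mat_cong_def by (meson cong_trans)

lemma mat_cong_sym: "mat_cong m X Y \<Longrightarrow> mat_cong m Y X"
  by (simp add: mat_cong_def cong_sym_eq)

lemma mat_cong_mult:
  "mat_cong m X X' \<Longrightarrow> mat_cong m Y Y' \<Longrightarrow> mat_cong m (X ** Y) (X' ** Y')"
  by (simp add: mat_cong_def matrix_matrix_mult_def cong_sum cong_mult)

lemma mat_pow_add: "mat_pow X (i + j) = mat_pow X i ** mat_pow X j"
  by (induction j) (simp_all add: matrix_mul_assoc)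

lemma mat_pow_mult: "mat_pow X (i * j) = mat_pow (mat_pow X i) j"
proof (induction j)
  case (Suc j)
  have "mat_pow X (i * Suc j) = mat_pow X (i * j) ** mat_pow X i"
    by (simp add: mat_pow_add[symmetric] add.commute)
  then show ?case using Suc by simp
qed simp

lemma mat_cong_pow_1: "mat_cong m X (mat 1) \<Longrightarrow> mat_cong m (mat_pow X i) (mat 1)"
proof (induction i)
  case (Suc i)
  then have "mat_cong m (mat_pow X i ** X) (mat 1 ** mat 1)"
    by (intro mat_cong_mult) auto
  then show ?case by simp
qed simp

lemma mat_cong_pow_exponent:
  assumes "mat_cong m (mat_pow X l) (mat 1)" and "[i = j] (mod l)"
  shows "mat_cong m (mat_pow X i) (mat_pow X j)"
proof -
  have *: "mat_cong m (mat_pow X i) (mat_pow X (i mod l))" for i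
  proof -
    have "mat_cong m (mat_pow (mat_pow X l) (i div l) ** mat_pow X (i mod l))
        (mat 1 ** mat_pow X (i mod l))"
      by (intro mat_cong_mult mat_cong_pow_1 assms(1) mat_cong_refl)
    then show ?thesis by (simp add: mat_pow_mult[symmetric] mat_pow_add[symmetric])
  qed
  show ?thesis
    using *[of i] *[of j] assms(2) mat_cong_sym mat_cong_trans unfolding cong_def by metis
qed

lemma mat_pow_left_inverse:
  assumes "mat_cong m (Y ** X) (mat 1)"
  shows "mat_cong m (mat_pow Y i ** mat_pow X i) (mat 1)"
proof (induction i)
  case (Suc i)
  have "mat_pow X (Suc i) = X ** mat_pow X i"
    using mat_pow_add[of X 1 i] by simp
  then have "mat_pow Y (Suc i) ** mat_pow X (Suc i) = mat_pow Y i ** ((Y ** X) ** mat_pow X i)"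
    by (simp add: matrix_mul_assoc)
  moreover have "mat_cong m \<dots> (mat_pow Y i ** (mat 1 ** mat_pow X i))"
    by (intro mat_cong_mult assms mat_cong_refl)
  ultimately show ?case using Suc mat_cong_trans by fastforce
qed simp

lemma mat_geom_Suc: "mat_geom (Suc l) X = mat_geom l X + mat_pow X l"
  by (simp add: mat_geom_def)

text \<open>Splitting the geometric sum after its first \<open>i\<close> terms leaves \<open>X\<^sup>i\<close> times a geometric sum. The
  statement is about the image of a vector because the sums occur only in that form.\<close>

lemma mat_geom_add: "v v* mat_geom (i + j) X = v v* mat_geom i X + v v* mat_geom j X v* mat_pow X i"
proof (induction j)
  case 0
  then show ?case by (simp add: mat_geom_def)
next
  case (Suc j)
  have "mat_pow X (i + j) = mat_pow X j ** mat_pow X i"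
    by (simp add: mat_pow_add[symmetric] add.commute)
  with Suc show ?case
    by (simp add: mat_geom_Suc vector_matrix_mult_add_rdistrib vector_matrix_left_distrib
        vector_matrix_mul_assoc)
qed

section \<open>Groups generated by the wreathed 2-group relations\<close>

abbreviation swap :: "int^2^2" where
  "swap \<equiv> mat2 0 1 1 0"

lemma swap_mult_swap: "swap ** swap = mat 1"
  by (simp add: mat2_def matrix_matrix_mult_def mat_def vec_eq_iff forall_2 sum_2)

lemma mat_pow_swap: "mat_pow swap e = (if even e then mat 1 else swap)"
  by (induction e) (simp_all add: swap_mult_swap)

text \<open>The ambient group may be larger than the subgroup generated by \<open>a\<close>, \<open>b\<close> and \<open>t\<close>: it is the
  wreathed group in one application and the extension in the other.\<close>

locale wreath_relations = group G for G (structure) +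
  fixes n :: nat and a b t :: 'a
  assumes a_closed [simp]: "a \<in> carrier G" and b_closed [simp]: "b \<in> carrier G"
    and t_closed [simp]: "t \<in> carrier G"
    and a_pow: "a [^] (2 ^ n :: nat) = \<one>" and b_pow: "b [^] (2 ^ n :: nat) = \<one>"
    and t_t: "t \<otimes> t = \<one>"
    and a_b: "a \<otimes> b = b \<otimes> a" and a_t: "a \<otimes> t = t \<otimes> b" and b_t: "b \<otimes> t = t \<otimes> a"

text \<open>The relations are conjugation rules. They are used in the form \<open>x g = g y\<close>, where powers of \<open>x\<close>
  and \<open>y\<close> can be taken on both sides.\<close>

lemma (in group) int_pow_intertwine:
  assumes "x \<otimes> g = g \<otimes> y" and [simp]: "x \<in> carrier G" "y \<in> carrier G" "g \<in> carrier G"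
  shows "x [^] (i::int) \<otimes> g = g \<otimes> y [^] i"
proof -
  have *: "x [^] (m::nat) \<otimes> g = g \<otimes> y [^] m" for m
  proof (induction m)
    case (Suc m)
    have "x [^] Suc m \<otimes> g = (x [^] m \<otimes> g) \<otimes> y"
      using assms(1) by (simp add: m_assoc)
    then show ?case using Suc by (simp add: m_assoc)
  qed simp
  show ?thesis
  proof (cases i)
    case (nonneg m)
    then show ?thesis using * by (simp add: int_pow_int)
  next
    case (neg m)
    define p q where "p = x [^] Suc m" and "q = y [^] Suc m"
    have [simp]: "p \<in> carrier G" "q \<in> carrier G" by (simp_all add: p_def q_def)
    have "inv p \<otimes> g = inv p \<otimes> (g \<otimes> q) \<otimes> inv q"
      by (simp add: m_assoc)
    also have "g \<otimes> q = p \<otimes> g"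
      unfolding p_def q_def by (rule *[symmetric])
    also have "inv p \<otimes> (p \<otimes> g) \<otimes> inv q = g \<otimes> inv q"
      by (simp add: m_assoc[symmetric])
    finally show ?thesis using neg by (metis int_pow_neg_int assms(2,3) p_def q_def)
  qed
qed

context wreath_relations
begin

text \<open>The exponents are arbitrary integers, which makes \<open>base\<close> a homomorphism from \<open>\<int>\<^sup>2\<close>; it
  factors through \<open>\<int>\<^sub>N\<^sup>2\<close> by \<open>base_cong\<close> below.\<close>

definition base :: "int^2 \<Rightarrow> 'a" where
  "base v = a [^] (v $ 1) \<otimes> b [^] (v $ 2)"

lemma base_closed [simp]: "base v \<in> carrier G"
  by (simp add: base_def)

lemma base_0 [simp]: "base 0 = \<one>"
  by (simp add: base_def)

lemma a_b_pow: "b [^] (j::int) \<otimes> a [^] (i::int) = a [^] i \<otimes> b [^] j"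
  by (intro int_pow_intertwine) (simp_all add: int_pow_intertwine[OF a_b, symmetric])

lemma base_add: "base (v + w) = base v \<otimes> base w"
proof -
  have "base v \<otimes> base w = a [^] (v $ 1) \<otimes> (b [^] (v $ 2) \<otimes> a [^] (w $ 1)) \<otimes> b [^] (w $ 2)"
    by (simp add: base_def m_assoc)
  also have "\<dots> = (a [^] (v $ 1) \<otimes> a [^] (w $ 1)) \<otimes> (b [^] (v $ 2) \<otimes> b [^] (w $ 2))"
    unfolding a_b_pow by (simp add: m_assoc)
  finally show ?thesis by (simp add: base_def int_pow_mult[symmetric])
qed

lemma base_minus: "base (- v) = inv (base v)"
  using base_add[of "- v" v] by (metis base_0 base_closed inv_equality add.left_inverse)

lemma base_scale: "base (i *s v) = base v [^] i"
proof -
  have *: "base (int m *s v) = base v [^] m" for m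
  proof (induction m)
    case (Suc m)
    have "int (Suc m) *s v = int m *s v + v"
      by (simp add: vec_eq_iff algebra_simps)
    then show ?case using Suc by (simp add: base_add)
  qed simp
  show ?thesis
  proof (cases i)
    case (nonneg m)
    then show ?thesis using * by (simp add: int_pow_int)
  next
    case (neg m)
    have "i *s v = - (int (Suc m) *s v)"
      unfolding neg by (simp add: vec_eq_iff algebra_simps)
    then show ?thesis unfolding neg using *[of "Suc m"]
      by (metis base_minus int_pow_neg_int base_closed)
  qed
qed

lemma base_cong:
  assumes "vec_cong (2 ^ n) v w"
  shows "base v = base w"
proof -
  have pow: "x [^] i = x [^] j"
    if "[i = j] (mod 2 ^ n)" "x \<in> carrier G" "x [^] (2 ^ n :: nat) = \<one>" for x and i j :: int
  proof -
    from that(1) have "2 ^ n dvd i - j"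
      by (simp add: cong_iff_dvd_diff)
    then obtain q where "i - j = 2 ^ n * q" by (rule dvdE)
    then have q: "i = j + 2 ^ n * q" by simp
    have "x [^] ((2::int) ^ n) = \<one>"
      using that(3) int_pow_int[of G x "2 ^ n"] by simp
    then have "x [^] ((2::int) ^ n * q) = \<one>"
      using that(2) by (simp flip: int_pow_pow)
    then show ?thesis using that(2) by (simp add: q int_pow_mult)
  qed
  show ?thesis
    using assms pow[OF _ a_closed a_pow] pow[OF _ b_closed b_pow]
    unfolding base_def vec_cong_def forall_2 by metis
qed

text \<open>An element that conjugates \<open>a\<close> and \<open>b\<close> into the base by the rows of \<open>X\<close> acts on the whole base
  as right multiplication of exponent vectors by \<open>X\<close>.\<close>

lemma base_intertwine:
  assumes "a \<otimes> g = g \<otimes> base (X $ 1)" "b \<otimes> g = g \<otimes> base (X $ 2)" and [simp]: "g \<in> carrier G"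
  shows "base v \<otimes> g = g \<otimes> base (v v* X)"
proof -
  have "base v \<otimes> g = a [^] (v $ 1) \<otimes> (b [^] (v $ 2) \<otimes> g)"
    by (simp add: base_def m_assoc)
  also have "b [^] (v $ 2) \<otimes> g = g \<otimes> base (X $ 2) [^] (v $ 2)"
    using assms by (intro int_pow_intertwine) auto
  also have "a [^] (v $ 1) \<otimes> (g \<otimes> base (X $ 2) [^] (v $ 2))
      = (a [^] (v $ 1) \<otimes> g) \<otimes> base (X $ 2) [^] (v $ 2)"
    by (simp add: m_assoc)
  also have "a [^] (v $ 1) \<otimes> g = g \<otimes> base (X $ 1) [^] (v $ 1)"
    using assms by (intro int_pow_intertwine) auto
  also have "g \<otimes> base (X $ 1) [^] (v $ 1) \<otimes> base (X $ 2) [^] (v $ 2)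
      = g \<otimes> base (v $ 1 *s X $ 1 + v $ 2 *s X $ 2)"
    by (simp add: base_add base_scale m_assoc)
  also have "v $ 1 *s X $ 1 + v $ 2 *s X $ 2 = v v* X"
    by (simp add: vec_eq_iff vector_matrix_mult_def sum_2)
  finally show ?thesis .
qed

lemma base_1_0: "base (vector [1, 0]) = a" and base_0_1: "base (vector [0, 1]) = b"
  by (simp_all add: base_def)

lemma base_t: "base v \<otimes> t = t \<otimes> base (v v* swap)"
  by (rule base_intertwine) (simp_all add: mat2_def base_1_0 base_0_1 a_t b_t)

lemma t_base: "t \<otimes> base v = base (v v* swap) \<otimes> t"
  by (simp add: base_t vector_matrix_mul_assoc swap_mult_swap)

lemma t_pow_base: "t [^] (e::nat) \<otimes> base v = base (v v* mat_pow swap e) \<otimes> t [^] e"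
proof (induction e arbitrary: v)
  case (Suc e)
  have "t [^] Suc e \<otimes> base v = t [^] e \<otimes> (t \<otimes> base v)"
    by (simp add: m_assoc)
  also have "\<dots> = (t [^] e \<otimes> base (v v* swap)) \<otimes> t"
    by (simp add: t_base m_assoc)
  also have "\<dots> = base (v v* (swap ** mat_pow swap e)) \<otimes> t [^] Suc e"
    by (simp add: Suc m_assoc vector_matrix_mul_assoc)
  also have "swap ** mat_pow swap e = mat_pow swap (Suc e)"
    using mat_pow_add[of swap 1 e] by simp
  finally show ?case .
qed simp

lemma t_pow_mod: "t [^] e = t [^] (e mod 2 :: nat)"
proof -
  have "t [^] (2 * (e div 2) + e mod 2) = t [^] (e mod 2)"
    by (subst nat_pow_mult[symmetric], simp, subst nat_pow_pow[symmetric], simp)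
      (simp add: numeral_2_eq_2 t_t)
  then show ?thesis by simp
qed

lemma t_pow_even: "even e \<Longrightarrow> t [^] (e::nat) = \<one>"
  by (subst t_pow_mod) simp

lemma base_t_pow_mult:
  "(base v \<otimes> t [^] e) \<otimes> (base w \<otimes> t [^] (f::nat))
     = base (v + w v* mat_pow swap e) \<otimes> t [^] (e + f)"
proof -
  have "(base v \<otimes> t [^] e) \<otimes> (base w \<otimes> t [^] f) = base v \<otimes> (t [^] e \<otimes> base w) \<otimes> t [^] f"
    by (simp add: m_assoc)
  then show ?thesis
    unfolding t_pow_base by (simp add: m_assoc base_add nat_pow_mult)
qed

lemma inv_base_t_pow:
  "inv (base v \<otimes> t [^] (e::nat)) = base (- (v v* mat_pow swap e)) \<otimes> t [^] e"
  by (rule inv_equality) (simp_all add: base_t_pow_mult t_pow_even del: nat_pow_Suc)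

lemma base_in_generate:
  assumes "a \<in> S" "b \<in> S" "S \<subseteq> carrier G"
  shows "base v \<in> generate G S"
proof -
  have *: "x [^] (i::int) \<in> generate G S" if "x \<in> S" for x i
    using subgroup_int_pow_closed[OF generate_is_subgroup[OF assms(3)]] that generate.incl
    by metis
  show ?thesis unfolding base_def by (intro generate.eng * assms)
qed

lemma generate_base: "generate G {a, b} = range base"
proof
  show "generate G {a, b} \<subseteq> range base"
  proof
    fix x assume "x \<in> generate G {a, b}"
    then have "\<exists>v. x = base v"
    proof induction
      case one
      then show ?case using base_0 by metis
    next
      case (incl x)
      then show ?case using base_1_0 base_0_1 by (metis insert_iff singletonD)
    next
      case (inv x)
      then have "x = base (vector [1, 0]) \<or> x = base (vector [0, 1])"
        by (auto simp: base_1_0 base_0_1)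
      then show ?case using base_minus by metis
    next
      case (eng x y)
      then show ?case using base_add by metis
    qed
    then show "x \<in> range base" by blast
  qed
qed (auto intro: base_in_generate)

text \<open>The elements \<open>base v t\<^sup>e\<close> contain the generators, and by \<open>base_t_pow_mult\<close> and \<open>inv_base_t_pow\<close> they are
  closed under multiplication and inverses.\<close>

lemma generate_wreath: "generate G {a, b, t} = {base v \<otimes> t [^] e | v e :: nat. True}"
proof
  let ?S = "{base v \<otimes> t [^] e | v e :: nat. True}"
  have gens: "a \<in> ?S" "b \<in> ?S" "t \<in> ?S"
  proof -
    have "a = base (vector [1, 0]) \<otimes> t [^] (0::nat)" "b = base (vector [0, 1]) \<otimes> t [^] (0::nat)"
      "t = base 0 \<otimes> t [^] (1::nat)"
      by (simp_all add: base_1_0 base_0_1 del: base_0) simp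
    then show "a \<in> ?S" "b \<in> ?S" "t \<in> ?S" by blast+
  qed
  show "generate G {a, b, t} \<subseteq> ?S"
  proof
    fix x assume "x \<in> generate G {a, b, t}"
    then show "x \<in> ?S"
    proof induction
      case one
      have "\<one> = base 0 \<otimes> t [^] (0::nat)" by simp
      then show ?case by blast
    next
      case (incl x)
      then show ?case using gens by blast
    next
      case (inv x)
      then have "x \<in> ?S" using gens by blast
      then show ?case using inv_base_t_pow by blast
    next
      case (eng x y)
      then show ?case using base_t_pow_mult by blast
    qed
  qed
  have "t [^] (e::nat) \<in> generate G {a, b, t}" for e
    by (induction e) (auto intro: generate.intros)
  then show "?S \<subseteq> generate G {a, b, t}"
    by (auto intro!: generate.eng base_in_generate)
qed

text \<open>No collapse beyond the relations of the wreathed group: the trivial element has only the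
  evident representations \<open>base v t\<^sup>e\<close>.\<close>

definition faithful :: bool where
  "faithful \<longleftrightarrow> (\<forall>v (e::nat). base v \<otimes> t [^] e = \<one> \<longrightarrow> vec_cong (2 ^ n) v 0 \<and> even e)"

lemma base_eq_imp_vec_cong:
  assumes faithful "base v = base w"
  shows "vec_cong (2 ^ n) v w"
proof -
  have "base (v - w) = base v \<otimes> base (- w)"
    by (simp flip: base_add)
  then have "base (v - w) \<otimes> t [^] (0::nat) = \<one>"
    using assms(2) by (simp add: base_minus)
  then have "vec_cong (2 ^ n) (v - w) 0"
    using assms(1) unfolding faithful_def by blast
  then show ?thesis by (simp only: vec_cong_diff_0)
qed

definition wreath_box :: "(int \<times> int \<times> nat) set" where
  "wreath_box = {0..<2 ^ n} \<times> {0..<2 ^ n} \<times> {0..<2}"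

definition box_elem :: "int \<times> int \<times> nat \<Rightarrow> 'a" where
  "box_elem = (\<lambda>(i, j, e). base (vector [i, j]) \<otimes> t [^] e)"

lemma card_wreath_box: "card wreath_box = 2 * (2 ^ n) ^ 2" and finite_wreath_box: "finite wreath_box"
  by (simp_all add: wreath_box_def card_cartesian_product power2_eq_square nat_power_eq)

lemma box_elem_reduce:
  "base v \<otimes> t [^] e = box_elem (v $ 1 mod 2 ^ n, v $ 2 mod 2 ^ n, e mod 2)"
proof -
  have "base v = base (vector [v $ 1 mod 2 ^ n, v $ 2 mod 2 ^ n])"
    by (rule base_cong) (simp add: vec_cong_def forall_2)
  then show ?thesis by (simp add: box_elem_def t_pow_mod[symmetric])
qed

lemma generate_wreath_box: "generate G {a, b, t} = box_elem ` wreath_box"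
proof
  show "generate G {a, b, t} \<subseteq> box_elem ` wreath_box"
    unfolding generate_wreath by (auto simp: box_elem_reduce wreath_box_def)
  show "box_elem ` wreath_box \<subseteq> generate G {a, b, t}"
    unfolding generate_wreath box_elem_def by auto
qed

lemma finite_generate_wreath: "finite (generate G {a, b, t})"
  unfolding generate_wreath_box using finite_wreath_box by simp

lemma card_generate_wreath_le: "card (generate G {a, b, t}) \<le> 2 * (2 ^ n) ^ 2"
  using card_image_le[OF finite_wreath_box, of box_elem]
  by (simp add: generate_wreath_box card_wreath_box)

text \<open>The map \<open>box_elem\<close> from a box of \<open>2N\<^sup>2\<close> exponents is onto, so the subgroup has \<open>2N\<^sup>2\<close> elements
  exactly when this map is injective.\<close>

lemma faithful_iff_card: "faithful \<longleftrightarrow> card (generate G {a, b, t}) = 2 * (2 ^ n) ^ 2"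
proof
  assume faithful
  have "inj_on box_elem wreath_box"
  proof (rule inj_onI)
    fix x y
    assume xy: "x \<in> wreath_box" "y \<in> wreath_box" "box_elem x = box_elem y"
    obtain i j e i' j' e' where x: "x = (i, j, e)" and y: "y = (i', j', e')"
      by (metis prod_cases3)
    have box: "(i, j, e) \<in> wreath_box" "(i', j', e') \<in> wreath_box"
      and eq: "box_elem (i, j, e) = box_elem (i', j', e')"
      using xy by (simp_all add: x y)
    let ?v = "vector [i, j] :: int^2" and ?v' = "vector [i', j'] :: int^2"
    have "(base ?v \<otimes> t [^] e) \<otimes> inv (base ?v' \<otimes> t [^] e') = \<one>"
      using eq by (simp add: box_elem_def)
    then have *: "vec_cong (2 ^ n) (?v + - (?v' v* mat_pow swap e') v* mat_pow swap e) 0" "even (e + e')"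
      using \<open>faithful\<close> unfolding inv_base_t_pow base_t_pow_mult faithful_def by blast+
    have "e = e'"
      using *(2) box by (auto simp: wreath_box_def less_2_cases_iff)
    then have "- (?v' v* mat_pow swap e') v* mat_pow swap e = - ?v'"
      by (simp add: vector_matrix_mult_minus vector_matrix_mul_assoc mat_pow_swap swap_mult_swap)
    then have "vec_cong (2 ^ n) (?v - ?v') 0"
      using *(1) by simp
    then have "[i = i'] (mod 2 ^ n)" "[j = j'] (mod 2 ^ n)"
      unfolding vec_cong_diff_0 by (simp_all add: vec_cong_def forall_2)
    then show "x = y"
      unfolding x y using box \<open>e = e'\<close> cong_less_imp_eq_int unfolding wreath_box_def
      by (metis SigmaD1 SigmaD2 atLeastLessThan_iff)
  qed
  then show "card (generate G {a, b, t}) = 2 * (2 ^ n) ^ 2"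
    unfolding generate_wreath_box by (simp add: card_image card_wreath_box)
next
  assume "card (generate G {a, b, t}) = 2 * (2 ^ n) ^ 2"
  then have inj: "inj_on box_elem wreath_box"
    using eq_card_imp_inj_on[OF finite_wreath_box]
    by (simp add: generate_wreath_box card_wreath_box)
  show faithful
    unfolding faithful_def
  proof (intro allI impI)
    fix v and e :: nat
    assume "base v \<otimes> t [^] e = \<one>"
    then have "box_elem (v $ 1 mod 2 ^ n, v $ 2 mod 2 ^ n, e mod 2) = box_elem (0, 0, 0)"
      using box_elem_reduce[of 0 0] by (simp add: box_elem_reduce)
    then have "(v $ 1 mod 2 ^ n, v $ 2 mod 2 ^ n, e mod 2) = (0, 0, 0)"
      by (rule inj_onD[OF inj]) (auto simp: wreath_box_def)
    then show "vec_cong (2 ^ n) v 0 \<and> even e"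
      by (auto simp: vec_cong_def forall_2 cong_def)
  qed
qed

end

section \<open>Groups generated by the extension relations\<close>

lemma mult_swap_swap: "X ** swap ** swap = X"
  by (simp add: swap_mult_swap flip: matrix_mul_assoc)

lemma (in wreath_relations) base_diff: "base (v - w) = base v \<otimes> base (- w)"
  by (simp flip: base_add)

text \<open>The number \<open>d\<close> stands for \<open>2c\<close> and \<open>k\<close> for \<open>1 - 2c\<close>, so that \<open>k + d = 1\<close> modulo 4. The vector \<open>w\<close>
  is \<open>(r, s)\<close>. The inverse power of \<open>Z\<close> is encoded by a vector \<open>u\<close> with \<open>u Z\<^sup>d = w\<close>, which makes all
  exponents natural numbers.\<close>

locale extension_parameters =
  fixes n :: nat and Z :: "int^2^2" and u w :: "int^2" and d k :: nat
  assumes u: "vec_cong (2 ^ n) (u v* mat_pow Z d) w"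
    and k_d: "[k + d = 1] (mod 4)" and odd_k: "odd k"
begin

text \<open>The four conditions of the criterion, with the sequences \<open>A\<^sub>j\<close> and \<open>B\<^sub>j\<close> replaced by the matrix
  powers that they describe.\<close>

definition compatible :: bool where
  "compatible \<longleftrightarrow> mat_cong (2 ^ n) (mat_pow Z 4) (mat 1)
    \<and> mat_cong (2 ^ n) (mat_pow Z k) (swap ** Z ** swap)
    \<and> vec_cong (2 ^ n) (u v* (mat_geom k (mat_pow Z k) + swap)) 0
    \<and> vec_cong (2 ^ n) (u v* mat_geom 4 (mat_pow Z k)) 0"

lemma k_k: "[k * k = 1] (mod 4)"
proof -
  obtain q where "k = 2 * q + 1" using odd_k by (elim oddE)
  then have "k * k = 4 * (q * q + q) + 1" by (simp add: algebra_simps)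
  then show ?thesis by (simp add: cong_def)
qed

end

locale extension_relations = wreath_relations G n a b t + extension_parameters n Z u w d k
  for G (structure) and n a b t Z u w d k +
  fixes z
  assumes z_closed [simp]: "z \<in> carrier G"
    and z_pow: "z [^] (4::nat) = \<one>"
    and a_z: "a \<otimes> z = z \<otimes> base (Z $ 1)" and b_z: "b \<otimes> z = z \<otimes> base (Z $ 2)"
    and t_z_w: "t \<otimes> z = z \<otimes> t \<otimes> z [^] d \<otimes> base w"
begin

lemma z_pow_cong: "[i = j] (mod 4) \<Longrightarrow> z [^] (i::nat) = z [^] (j::nat)"
proof -
  have *: "z [^] i = z [^] (i mod 4)" for i :: nat
  proof -
    have "z [^] (4 * (i div 4) + i mod 4) = (z [^] (4::nat)) [^] (i div 4) \<otimes> z [^] (i mod 4)"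
      by (simp add: nat_pow_mult nat_pow_pow)
    also have "\<dots> = z [^] (i mod 4)"
      by (simp add: z_pow)
    finally show ?thesis by simp
  qed
  show "z [^] i = z [^] j" if "[i = j] (mod 4)"
    using that *[of i] *[of j] by (simp add: cong_def)
qed

lemma base_z: "base v \<otimes> z = z \<otimes> base (v v* Z)"
  by (rule base_intertwine) (simp_all add: a_z b_z)

lemma base_z_pow: "base v \<otimes> z [^] (i::nat) = z [^] i \<otimes> base (v v* mat_pow Z i)"
proof (induction i)
  case (Suc i)
  have "base v \<otimes> z [^] Suc i = (base v \<otimes> z [^] i) \<otimes> z"
    by (simp add: m_assoc)
  also have "\<dots> = z [^] i \<otimes> (base (v v* mat_pow Z i) \<otimes> z)"
    by (simp add: Suc m_assoc)
  also have "\<dots> = z [^] Suc i \<otimes> base (v v* mat_pow Z (Suc i))"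
    by (simp add: base_z m_assoc vector_matrix_mul_assoc)
  finally show ?case .
qed simp

text \<open>The last relation of the presentation, with \<open>z\<^sup>d\<close> moved past the base and cancelled.\<close>

lemma t_z_pow_k: "t \<otimes> z [^] k = z \<otimes> t \<otimes> base u"
proof -
  have "(t \<otimes> z [^] k) \<otimes> z [^] d = t \<otimes> z [^] (k + d)"
    by (simp add: m_assoc nat_pow_mult)
  also have "\<dots> = t \<otimes> z"
    using z_pow_cong[OF k_d] by simp
  also have "\<dots> = z \<otimes> t \<otimes> (z [^] d \<otimes> base (u v* mat_pow Z d))"
    using base_cong[OF u] by (simp add: t_z_w m_assoc)
  also have "\<dots> = (z \<otimes> t \<otimes> base u) \<otimes> z [^] d"
    by (simp add: base_z_pow[symmetric] m_assoc)
  finally show ?thesis by simp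
qed

lemma z_t: "z \<otimes> t = t \<otimes> z [^] k \<otimes> base (- u)"
  unfolding t_z_pow_k by (simp add: base_minus m_assoc)

lemma t_z: "t \<otimes> z = z [^] k \<otimes> base (- u) \<otimes> t"
proof -
  have "t \<otimes> z = t \<otimes> (z \<otimes> t) \<otimes> t"
    by (simp add: m_assoc t_t)
  also have "\<dots> = (t \<otimes> t) \<otimes> z [^] k \<otimes> base (- u) \<otimes> t"
    unfolding z_t by (simp add: m_assoc)
  finally show ?thesis by (simp add: t_t)
qed

text \<open>Moving \<open>t\<close> past \<open>z\<close> produces one factor \<open>z\<^sup>k base (- u)\<close> each time; collecting the powers of \<open>z\<close> on the
  left turns the base parts into a geometric sum.\<close>

lemma z_pow_t:
  "z [^] (i::nat) \<otimes> t = t \<otimes> z [^] (k * i) \<otimes> base (- (u v* mat_geom i (mat_pow Z k)))"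
proof (induction i)
  case (Suc i)
  let ?v = "- (u v* mat_geom i (mat_pow Z k))"
  have "z [^] Suc i \<otimes> t = z \<otimes> (z [^] i \<otimes> t)"
    using nat_pow_Suc2[OF z_closed, of i] by (simp add: m_assoc)
  also have "\<dots> = (z \<otimes> t) \<otimes> z [^] (k * i) \<otimes> base ?v"
    by (simp add: Suc m_assoc)
  also have "\<dots> = t \<otimes> z [^] k \<otimes> (base (- u) \<otimes> z [^] (k * i)) \<otimes> base ?v"
    by (simp add: z_t m_assoc)
  also have "\<dots> = t \<otimes> z [^] (k * Suc i) \<otimes> base (- u v* mat_pow Z (k * i) + ?v)"
    by (simp add: base_z_pow m_assoc base_diff) (simp add: m_assoc[symmetric] nat_pow_mult)
  also have "- u v* mat_pow Z (k * i) + ?v = - (u v* mat_geom (Suc i) (mat_pow Z k))"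
    by (simp add: mat_geom_Suc vector_matrix_mult_add_rdistrib vector_matrix_mult_minus mat_pow_mult)
  finally show ?case .
qed (simp add: mat_geom_def)

text \<open>Each condition compares two normal forms of one group element. Since the base is faithful, the
  exponent vectors must agree modulo \<open>N\<close>.\<close>

lemma faithful_imp_compatible:
  assumes faithful
  shows compatible
  unfolding compatible_def
proof (intro conjI)
  note inj = base_eq_imp_vec_cong[OF \<open>faithful\<close>]
  show "mat_cong (2 ^ n) (mat_pow Z 4) (mat 1)"
  proof (rule mat_congI, rule inj)
    show "base (v v* mat_pow Z 4) = base (v v* mat 1)" for v
      using base_z_pow[of v 4] by (simp add: z_pow)
  qed
  have "mat_cong (2 ^ n) (Z ** swap) (swap ** mat_pow Z k)"
  proof (rule mat_congI, rule inj)
    fix v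
    have "z \<otimes> t \<otimes> base (v v* (Z ** swap)) = base v \<otimes> (z \<otimes> t)"
      by (simp add: m_assoc[symmetric] base_z)
        (simp add: m_assoc base_t vector_matrix_mul_assoc)
    also have "\<dots> = (base v \<otimes> t) \<otimes> z [^] k \<otimes> base (- u)"
      by (simp add: z_t m_assoc)
    also have "\<dots> = t \<otimes> (base (v v* swap) \<otimes> z [^] k) \<otimes> base (- u)"
      by (simp add: base_t m_assoc)
    also have "\<dots> = t \<otimes> z [^] k \<otimes> base (v v* (swap ** mat_pow Z k) + - u)"
      unfolding base_z_pow base_add by (simp add: m_assoc vector_matrix_mul_assoc)
    also have "\<dots> = z \<otimes> t \<otimes> base (v v* (swap ** mat_pow Z k))"
      unfolding add.commute[of _ "- u"] base_add z_t by (simp add: m_assoc)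
    finally show "base (v v* (Z ** swap)) = base (v v* (swap ** mat_pow Z k))"
      by simp
  qed
  then have "mat_cong (2 ^ n) (swap ** (Z ** swap)) (swap ** (swap ** mat_pow Z k))"
    by (rule mat_cong_mult[OF mat_cong_refl])
  then show "mat_cong (2 ^ n) (mat_pow Z k) (swap ** Z ** swap)"
    by (simp add: matrix_mul_assoc swap_mult_swap mat_cong_sym)
  show "vec_cong (2 ^ n) (u v* (mat_geom k (mat_pow Z k) + swap)) 0"
  proof (rule inj)
    let ?v = "- (u v* mat_geom k (mat_pow Z k))"
    have "z = (z \<otimes> t) \<otimes> t"
      by (simp add: m_assoc t_t)
    also have "\<dots> = t \<otimes> z [^] k \<otimes> (base (- u) \<otimes> t)"
      by (simp add: z_t m_assoc)
    also have "\<dots> = t \<otimes> (z [^] k \<otimes> t) \<otimes> base (- u v* swap)"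
      by (simp add: base_t m_assoc)
    also have "\<dots> = (t \<otimes> t) \<otimes> z [^] (k * k) \<otimes> base (?v + - u v* swap)"
      unfolding z_pow_t base_add by (simp add: m_assoc)
    also have "\<dots> = z \<otimes> base (?v + - u v* swap)"
      using z_pow_cong[OF k_k] by (simp add: t_t)
    also have "?v + - u v* swap = - (u v* (mat_geom k (mat_pow Z k) + swap))"
      by (simp add: vector_matrix_mult_minus vector_matrix_mult_add_rdistrib)
    finally have "base (- (u v* (mat_geom k (mat_pow Z k) + swap))) = \<one>"
      by (simp only: l_cancel_one' base_closed z_closed)
    then show "base (u v* (mat_geom k (mat_pow Z k) + swap)) = base 0"
      by (simp add: base_minus)
  qed
  show "vec_cong (2 ^ n) (u v* mat_geom 4 (mat_pow Z k)) 0"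
  proof (rule inj)
    have "t = z [^] (4::nat) \<otimes> t"
      by (simp add: z_pow)
    also have "\<dots> = t \<otimes> z [^] (k * 4) \<otimes> base (- (u v* mat_geom 4 (mat_pow Z k)))"
      by (rule z_pow_t)
    also have "z [^] (k * 4) = \<one>"
      using z_pow_cong[of "k * 4" 0] by (simp add: cong_def)
    finally have "base (- (u v* mat_geom 4 (mat_pow Z k))) = \<one>"
      by (simp only: l_cancel_one' base_closed t_closed r_one)
    then show "base (u v* mat_geom 4 (mat_pow Z k)) = base 0"
      by (simp add: base_minus)
  qed
qed

end

locale extension_group = extension_relations +
  assumes generated: "carrier G = generate G {a, b, t, z}"
begin

definition normal_forms :: "'a set" where
  "normal_forms = {z [^] i \<otimes> base v \<otimes> t [^] e | (i :: nat) v (e :: nat). True}"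

lemma normal_formsI: "z [^] (i::nat) \<otimes> base v \<otimes> t [^] (e::nat) \<in> normal_forms"
  unfolding normal_forms_def by blast

lemma normal_forms_base: "x \<in> normal_forms \<Longrightarrow> x \<otimes> base v \<in> normal_forms"
proof -
  assume "x \<in> normal_forms"
  then obtain i e :: nat and v' where "x = z [^] i \<otimes> base v' \<otimes> t [^] e"
    unfolding normal_forms_def by blast
  then have "x \<otimes> base v = z [^] i \<otimes> base v' \<otimes> (t [^] e \<otimes> base v)"
    by (simp add: m_assoc)
  also have "\<dots> = z [^] i \<otimes> base (v' + v v* mat_pow swap e) \<otimes> t [^] e"
    by (simp add: t_pow_base m_assoc base_add)
  finally show ?thesis by (simp add: normal_formsI)
qed

lemma normal_forms_t: "x \<in> normal_forms \<Longrightarrow> x \<otimes> t \<in> normal_forms"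
proof -
  assume "x \<in> normal_forms"
  then obtain i e :: nat and v where "x = z [^] i \<otimes> base v \<otimes> t [^] e"
    unfolding normal_forms_def by blast
  then have "x \<otimes> t = z [^] i \<otimes> base v \<otimes> t [^] Suc e"
    by (simp add: m_assoc)
  then show ?thesis by (simp only: normal_formsI)
qed

lemma normal_forms_z: "x \<in> normal_forms \<Longrightarrow> x \<otimes> z \<in> normal_forms"
proof -
  assume "x \<in> normal_forms"
  then obtain i e :: nat and v where x: "x = z [^] i \<otimes> base v \<otimes> t [^] e"
    unfolding normal_forms_def by blast
  show ?thesis
  proof (cases "even e")
    case True
    then have "x \<otimes> z = z [^] i \<otimes> (base v \<otimes> z)"
      by (simp add: x t_pow_even m_assoc)
    also have "\<dots> = z [^] Suc i \<otimes> base (v v* Z) \<otimes> t [^] (0::nat)"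
      by (simp add: base_z m_assoc)
    finally show ?thesis by (simp only: normal_formsI)
  next
    case False
    then have "t [^] e = t"
      using t_pow_mod[of e] by (simp add: odd_iff_mod_2_eq_one)
    then have "x \<otimes> z = z [^] i \<otimes> (base v \<otimes> z [^] k) \<otimes> base (- u) \<otimes> t"
      by (simp add: x m_assoc t_z)
    also have "\<dots> = (z [^] i \<otimes> z [^] k) \<otimes> (base (v v* mat_pow Z k) \<otimes> base (- u)) \<otimes> t"
      unfolding base_z_pow by (simp add: m_assoc)
    also have "\<dots> = z [^] (i + k) \<otimes> base (v v* mat_pow Z k + - u) \<otimes> t [^] (1::nat)"
      by (simp add: nat_pow_mult base_diff)
    finally show ?thesis by (simp only: normal_formsI)
  qed
qed

lemma normal_forms_mult: "x \<in> normal_forms \<Longrightarrow> y \<in> normal_forms \<Longrightarrow> x \<otimes> y \<in> normal_forms"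
proof -
  assume x: "x \<in> normal_forms" and "y \<in> normal_forms"
  then obtain i e :: nat and v where y: "y = z [^] i \<otimes> base v \<otimes> t [^] e"
    unfolding normal_forms_def by blast
  have closed: "x \<in> carrier G"
    using x unfolding normal_forms_def by auto
  have "x \<otimes> z [^] j \<in> normal_forms" for j :: nat
  proof (induction j)
    case (Suc j)
    then have "x \<otimes> z [^] j \<otimes> z \<in> normal_forms" by (rule normal_forms_z)
    then show ?case using closed by (simp add: m_assoc)
  qed (simp add: x closed)
  then have *: "x \<otimes> z [^] i \<otimes> base v \<in> normal_forms"
    by (rule normal_forms_base)
  have "x \<otimes> z [^] i \<otimes> base v \<otimes> t [^] j \<in> normal_forms" for j :: nat
  proof (induction j)
    case (Suc j)
    then have "x \<otimes> z [^] i \<otimes> base v \<otimes> t [^] j \<otimes> t \<in> normal_forms" by (rule normal_forms_t)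
    then show ?case using closed by (simp add: m_assoc)
  qed (use * closed in simp)
  then show ?thesis using closed by (simp add: y m_assoc)
qed

text \<open>The inverse of each generator is again a normal form, so what matters is closure under
  multiplication: a generator on the right is moved past \<open>t\<^sup>e\<close> and \<open>base v\<close>.\<close>

lemma carrier_normal_forms: "carrier G = normal_forms"
proof
  have base: "base v \<in> normal_forms" for v
    using normal_formsI[of 0 v 0] by simp
  have t: "t \<in> normal_forms"
    using normal_formsI[of 0 0 1] by simp
  have z: "z [^] i \<in> normal_forms" for i :: nat
    using normal_formsI[of i 0 0] by simp
  have inv_t: "inv t = t" and inv_z: "inv z = z [^] (3::nat)"
    using t_t z_pow by (auto intro!: inv_equality simp: numeral_eq_Suc)
  have "x \<in> normal_forms" if "x \<in> generate G {a, b, t, z}" for x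
    using that
  proof induction
    case one
    then show ?case using base[of 0] by simp
  next
    case (incl x)
    then show ?case using base[of "vector [1, 0]"] base[of "vector [0, 1]"] t z[of 1]
      by (auto simp: base_1_0 base_0_1)
  next
    case (inv x)
    then show ?case
      using base[of "- vector [1, 0]"] base[of "- vector [0, 1]"] t z[of 3]
      by (auto simp: base_minus base_1_0 base_0_1 inv_t inv_z)
  next
    case (eng x y)
    then show ?case by (simp add: normal_forms_mult)
  qed
  then show "carrier G \<subseteq> normal_forms" by (auto simp: generated)
qed (auto simp: normal_forms_def)

text \<open>Each factor of a normal form \<open>y\<close> can be moved past the base, so that \<open>base v y = y base v'\<close> for
  some \<open>v'\<close>. This is applied to \<open>y = inv x\<close>.\<close>

lemma base_normal: "generate G {a, b} \<lhd> G"
  unfolding normal_inv_iff generate_base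
proof (intro conjI ballI)
  show "subgroup (range base) G"
    unfolding generate_base[symmetric] by (rule generate_is_subgroup) simp
  fix x h
  assume "x \<in> carrier G" "h \<in> range base"
  then have x: "x \<in> carrier G" "inv x \<in> normal_forms" using carrier_normal_forms by auto
  obtain v where h: "h = base v" using \<open>h \<in> range base\<close> by blast
  obtain i e :: nat and v' where y: "inv x = z [^] i \<otimes> base v' \<otimes> t [^] e"
    using x(2) unfolding normal_forms_def by blast
  have comm: "base v \<otimes> base v' = base v' \<otimes> base v" for v v'
    by (simp add: base_add[symmetric] add.commute)
  let ?v = "v v* mat_pow Z i" and ?J = "mat_pow swap e"
  have "h \<otimes> inv x = (base v \<otimes> z [^] i) \<otimes> base v' \<otimes> t [^] e"
    by (simp add: h y m_assoc)
  also have "\<dots> = z [^] i \<otimes> (base ?v \<otimes> base v') \<otimes> t [^] e"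
    by (simp add: base_z_pow m_assoc)
  also have "\<dots> = z [^] i \<otimes> base v' \<otimes> (base (?v v* ?J v* ?J) \<otimes> t [^] e)"
    by (simp add: comm[of ?v] m_assoc vector_matrix_mul_assoc mat_pow_swap mult_swap_swap)
  also have "\<dots> = inv x \<otimes> base (?v v* ?J)"
    by (simp add: y m_assoc flip: t_pow_base)
  finally have "x \<otimes> h \<otimes> inv x = base (?v v* ?J)"
    using x(1) h by (simp add: m_assoc)  (simp add: m_assoc[symmetric])
  then show "x \<otimes> h \<otimes> inv x \<in> range base" by blast
qed

lemma generate_z: "generate G {z} = range (\<lambda>i::nat. z [^] i)"
proof
  have inv_z: "inv z = z [^] (3::nat)"
    using z_pow by (auto intro!: inv_equality simp: numeral_eq_Suc)
  have "\<exists>i::nat. x = z [^] i" if "x \<in> generate G {z}" for x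
    using that
  proof induction
    case one
    then show ?case by (metis nat_pow_0)
  next
    case (incl x)
    then show ?case by (intro exI[of _ 1]) simp
  next
    case (inv x)
    then show ?case using inv_z by blast
  next
    case (eng x y)
    then show ?case using nat_pow_mult by (metis z_closed)
  qed
  then show "generate G {z} \<subseteq> range (\<lambda>i::nat. z [^] i)" by blast
  have "z [^] (i::nat) \<in> generate G {z}" for i
    by (induction i) (auto intro: generate.intros)
  then show "range (\<lambda>i::nat. z [^] i) \<subseteq> generate G {z}" by blast
qed

definition faithful_normal_forms :: bool where
  "faithful_normal_forms \<longleftrightarrow> (\<forall>(i::nat) v (e::nat).
     z [^] i \<otimes> base v \<otimes> t [^] e = \<one> \<longrightarrow> 4 dvd i \<and> vec_cong (2 ^ n) v 0 \<and> even e)"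

lemma faithful_normal_forms_imp_faithful: "faithful_normal_forms \<Longrightarrow> faithful"
  unfolding faithful_normal_forms_def faithful_def
  by (metis base_closed l_one nat_pow_0)

text \<open>A normal form \<open>z\<^sup>i base v t\<^sup>e\<close> has its \<open>K\<close>-part on the left. Taking inverses of all elements
  gives \<open>G = H K\<close>.\<close>

lemma exact_product_normal_forms:
  assumes faithful_normal_forms
  shows "exact_product G (generate G {a, b, t}) (generate G {z})"
  unfolding exact_product_def
proof (intro conjI)
  show H: "subgroup (generate G {a, b, t}) G" and K: "subgroup (generate G {z}) G"
    by (simp_all add: generate_is_subgroup)
  have "x \<in> generate G {a, b, t} <#> generate G {z}" if "x \<in> carrier G" for x
  proof -
    have "inv x \<in> normal_forms" using that carrier_normal_forms by blast
    then obtain i e :: nat and v where y: "inv x = z [^] i \<otimes> (base v \<otimes> t [^] e)"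
      unfolding normal_forms_def by (auto simp: m_assoc)
    have "x = inv (base v \<otimes> t [^] e) \<otimes> inv (z [^] i)"
      using that y by (metis inv_inv inv_mult_group m_closed base_closed nat_pow_closed t_closed z_closed)
    moreover have "inv (base v \<otimes> t [^] e) \<in> generate G {a, b, t}"
      by (intro subgroup.m_inv_closed[OF H]) (auto simp: generate_wreath)
    moreover have "inv (z [^] i) \<in> generate G {z}"
      by (intro subgroup.m_inv_closed[OF K]) (auto simp: generate_z)
    ultimately show ?thesis unfolding set_mult_def by blast
  qed
  moreover have "generate G {a, b, t} <#> generate G {z} \<subseteq> carrier G"
    using subgroup.subset[OF H] subgroup.subset[OF K] set_mult_closed by blast
  ultimately show "carrier G = generate G {a, b, t} <#> generate G {z}" by blast
  have "x = \<one>" if x: "x \<in> generate G {a, b, t}" "x \<in> generate G {z}" for x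
  proof -
    obtain i e :: nat and v where h: "x = base v \<otimes> t [^] e" and k: "x = z [^] i"
      using x unfolding generate_wreath generate_z by blast
    \<comment> \<open>\<open>z\<close> to the power \<open>3 i\<close> is the inverse of \<open>z\<^sup>i\<close>; multiplying by it gives a normal form of \<open>1\<close>.\<close>
    have "z [^] (3 * i) \<otimes> base v \<otimes> t [^] e = z [^] (3 * i) \<otimes> z [^] i"
      using h k by (simp add: m_assoc)
    also have "\<dots> = \<one>"
      using z_pow_cong[of "3 * i + i" 0] by (simp add: nat_pow_mult cong_def)
    finally have "vec_cong (2 ^ n) v 0" "even e"
      using assms unfolding faithful_normal_forms_def by blast+
    then show ?thesis using base_cong[of v 0] by (simp add: h t_pow_even)
  qed
  then show "generate G {a, b, t} \<inter> generate G {z} = {\<one>}"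
    using generate.one by blast
qed

lemma generate_z_iso:
  assumes faithful_normal_forms
  shows "G\<lparr>carrier := generate G {z}\<rparr> \<cong> integer_mod_group 4"
proof -
  let ?h = "\<lambda>i::int. z [^] nat i"
  have "?h \<in> iso (integer_mod_group 4) (G\<lparr>carrier := generate G {z}\<rparr>)"
    unfolding iso_def
  proof (intro CollectI conjI homI bij_betw_imageI)
    fix i j
    assume ij: "i \<in> carrier (integer_mod_group 4)" "j \<in> carrier (integer_mod_group 4)"
    show "?h i \<in> carrier (G\<lparr>carrier := generate G {z}\<rparr>)"
      by (simp add: generate_z)
    have "nat ((i + j) mod 4) = (nat i + nat j) mod 4"
      using ij by (simp add: carrier_integer_mod_group nat_mod_distrib nat_add_distrib)
    then have "z [^] nat ((i + j) mod 4) = z [^] (nat i + nat j)"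
      using z_pow_cong[of "nat ((i + j) mod 4)" "nat i + nat j"] by (simp add: cong_def)
    then show "?h (i \<otimes>\<^bsub>integer_mod_group 4\<^esub> j) = ?h i \<otimes>\<^bsub>G\<lparr>carrier := generate G {z}\<rparr>\<^esub> ?h j"
      by (simp add: nat_pow_mult)
  next
    have *: "i = j" if "z [^] i = z [^] j" "i \<le> j" "j < 4" for i j :: nat
    proof -
      have "z [^] i \<otimes> z [^] (j - i) = z [^] j"
        using \<open>i \<le> j\<close> by (simp add: nat_pow_mult)
      also have "\<dots> = z [^] i"
        by (rule that(1)[symmetric])
      finally have "z [^] (j - i) \<otimes> base 0 \<otimes> t [^] (0::nat) = \<one>"
        by simp
      then have "4 dvd (j - i)"
        using assms unfolding faithful_normal_forms_def by blast
      then show ?thesis using that by (auto dest: dvd_imp_le)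
    qed
    show "inj_on ?h (carrier (integer_mod_group 4))"
    proof (rule inj_onI)
      fix i j
      assume "i \<in> carrier (integer_mod_group 4)" "j \<in> carrier (integer_mod_group 4)"
      then have ij: "0 \<le> i" "i < 4" "0 \<le> j" "j < 4"
        by (simp_all add: carrier_integer_mod_group)
      then have "nat i < 4" "nat j < 4" by simp_all
      moreover assume "?h i = ?h j"
      ultimately have "nat i = nat j"
        using *[of "nat i" "nat j"] *[of "nat j" "nat i"] by (metis nat_le_linear)
      then show "i = j" using ij by simp
    qed
    have "z [^] i \<in> ?h ` {0..<4}" for i :: nat
    proof (rule image_eqI)
      show "z [^] i = z [^] nat (int (i mod 4))"
        using z_pow_cong[of i "i mod 4"] by (simp add: cong_def)
    qed simp
    then have "?h ` {0..<4} = range (\<lambda>i::nat. z [^] i)" by blast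
    then show "?h ` carrier (integer_mod_group 4) = carrier (G\<lparr>carrier := generate G {z}\<rparr>)"
      by (simp add: carrier_integer_mod_group generate_z del: pow_nat)
  qed
  then show ?thesis
    by (rule group.iso_sym[OF group_integer_mod_group is_isoI])
qed

end

section \<open>The action on normal forms\<close>

type_synonym state = "nat \<times> (int^2) \<times> bool"

text \<open>The triple \<open>(i, v, e)\<close> stands for the normal form \<open>z\<^sup>i \<phi>(v) t\<^sup>e\<close>. Right multiplication by \<open>\<phi>(x)\<close>
  has to pass \<open>t\<^sup>e\<close>, which swaps the coordinates of \<open>x\<close> when \<open>e\<close> is true.\<close>

definition shift :: "int^2 \<Rightarrow> state \<Rightarrow> state" where
  "shift x = (\<lambda>(i, v, e). (i, v + (if e then x v* swap else x), e))"

definition flip :: "state \<Rightarrow> state" where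
  "flip = (\<lambda>(i, v, e). (i, v, \<not> e))"

lemma shift_shift: "shift y (shift x s) = shift (x + y) s"
  by (cases s) (simp add: shift_def vector_matrix_left_distrib)

lemma shift_pow: "shift x ^^ l = shift (int l *s x)"
proof (induction l)
  case 0
  have "shift 0 = id" by (simp add: shift_def fun_eq_iff)
  then show ?case by simp
next
  case (Suc l)
  have "int l *s x + x = int (Suc l) *s x"
    by (simp add: vec_eq_iff algebra_simps)
  then show ?case by (simp add: Suc fun_eq_iff shift_shift)
qed

lemma flip_flip: "flip (flip s) = s"
  by (cases s) (simp add: flip_def)

lemma flip_shift: "flip (shift x (flip s)) = shift (x v* swap) s"
  by (cases s) (simp add: flip_def shift_def vector_matrix_mul_assoc swap_mult_swap)

context extension_parameters
begin

text \<open>Right multiplication by \<open>z\<close> on normal forms: for \<open>e\<close> true, \<open>t z = z\<^sup>k \<phi>(-u) t\<close> (lemma \<open>t_z\<close>).\<close>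

definition turn :: "state \<Rightarrow> state" where
  "turn = (\<lambda>(i, v, e). if e then (i + k, v v* mat_pow Z k - u, True) else (i + 1, v v* Z, False))"

lemma turn_simps:
  "turn (i, v, False) = (i + 1, v v* Z, False)"
  "turn (i, v, True) = (i + k, v v* mat_pow Z k - u, True)"
  by (simp_all add: turn_def)

text \<open>The inverse of \<open>z\<close> acts as the cube of \<open>z\<close>. It is an inverse up to congruence, under the
  conditions that make the fourth power of \<open>turn\<close> trivial (lemma \<open>turn_pow_4\<close>).\<close>

fun letter_act :: "ext_gen \<times> bool \<Rightarrow> state \<Rightarrow> state" where
  "letter_act (Ga, e) = shift (if e then vector [1, 0] else - vector [1, 0])"
| "letter_act (Gb, e) = shift (if e then vector [0, 1] else - vector [0, 1])"
| "letter_act (Gt, e) = flip"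
| "letter_act (Gz, e) = (if e then turn else turn ^^ 3)"

definition state_cong :: "state \<Rightarrow> state \<Rightarrow> bool" where
  "state_cong = (\<lambda>(i, v, e) (i', v', e').
     [i = i'] (mod 4) \<and> vec_cong (2 ^ n) v v' \<and> e = e')"

lemma equivp_state_cong: "equivp state_cong"
  by (rule equivpI)
    (auto simp: reflp_def symp_def transp_def state_cong_def
      intro: cong_sym cong_trans vec_cong_sym vec_cong_trans)

lemma state_cong_refl [simp]: "state_cong s s"
  by (simp add: equivp_reflp[OF equivp_state_cong])

lemma state_cong_trans [trans]: "state_cong s s' \<Longrightarrow> state_cong s' s'' \<Longrightarrow> state_cong s s''"
  by (rule equivp_transp[OF equivp_state_cong])

lemma shift_cong: "vec_cong (2 ^ n) x y \<Longrightarrow> state_cong s s' \<Longrightarrow> state_cong (shift x s) (shift y s')"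
  by (cases s, cases s')
    (auto simp: state_cong_def shift_def intro: vec_cong_add vec_cong_vector_matrix_mult)

lemma flip_cong: "state_cong s s' \<Longrightarrow> state_cong (flip s) (flip s')"
  by (cases s, cases s') (auto simp: state_cong_def flip_def)

lemma turn_cong: "state_cong s s' \<Longrightarrow> state_cong (turn s) (turn s')"
proof -
  have "[Suc i = Suc i'] (mod 4)" if "[i = i'] (mod 4)" for i i' :: nat
    using cong_add[OF that cong_refl, of 1] by simp
  then show "state_cong s s' \<Longrightarrow> state_cong (turn s) (turn s')"
    by (cases s, cases s')
      (auto simp: state_cong_def turn_def cong_add_rcancel_nat
        intro: vec_cong_diff vec_cong_vector_matrix_mult)
qed

lemma turn_pow_cong: "state_cong s s' \<Longrightarrow> state_cong ((turn ^^ l) s) ((turn ^^ l) s')"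
  by (induction l) (simp_all add: turn_cong)

lemma letter_act_cong: "state_cong s s' \<Longrightarrow> state_cong (letter_act l s) (letter_act l s')"
  by (cases l rule: letter_act.cases)
    (simp_all add: shift_cong flip_cong turn_cong turn_pow_cong)

lemma turn_pow_False: "(turn ^^ l) (i, v, False) = (i + l, v v* mat_pow Z l, False)"
  by (induction l) (simp_all add: turn_def vector_matrix_mul_assoc)

lemma turn_pow_True:
  "(turn ^^ l) (i, v, True)
     = (i + k * l, v v* mat_pow Z (k * l) - u v* mat_geom l (mat_pow Z k), True)"
proof (induction l)
  case 0
  then show ?case by (simp add: mat_geom_def)
next
  case (Suc l)
  have "mat_pow Z (k + k * l) = mat_pow Z (k * l) ** mat_pow Z k"
    by (simp add: mat_pow_add[symmetric] add.commute)
  moreover have "u v* mat_geom (Suc l) (mat_pow Z k)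
      = u + u v* mat_geom l (mat_pow Z k) v* mat_pow Z k"
    using mat_geom_add[of u 1 l "mat_pow Z k"] by (simp add: mat_geom_def)
  ultimately show ?case
    using Suc by (simp add: turn_def vector_matrix_mult_diff_distrib vector_matrix_mul_assoc)
qed

end

locale compatible_parameters = extension_parameters +
  assumes compatible: compatible
begin

lemma Z_pow_4: "mat_cong (2 ^ n) (mat_pow Z 4) (mat 1)"
  and Z_pow_k: "mat_cong (2 ^ n) (mat_pow Z k) (swap ** Z ** swap)"
  and geom_k: "vec_cong (2 ^ n) (u v* (mat_geom k (mat_pow Z k) + swap)) 0"
  and geom_4: "vec_cong (2 ^ n) (u v* mat_geom 4 (mat_pow Z k)) 0"
  using compatible unfolding compatible_def by simp_all

lemma Z_pow_cong: "[i = j] (mod 4) \<Longrightarrow> mat_cong (2 ^ n) (mat_pow Z i) (mat_pow Z j)"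
  by (rule mat_cong_pow_exponent[OF Z_pow_4])

lemma swap_Z_pow_k: "mat_cong (2 ^ n) (swap ** mat_pow Z k) (Z ** swap)"
  using mat_cong_mult[OF mat_cong_refl Z_pow_k, of swap]
  by (simp add: matrix_mul_assoc swap_mult_swap)

lemma even_d: "even d"
proof -
  have "(k + d) mod 4 = 1" using k_d by (simp add: cong_def)
  then have "odd (k + d)" by presburger
  then show ?thesis using odd_k by simp
qed

lemma turn_pow_4: "state_cong ((turn ^^ 4) s) s"
proof -
  obtain i v e where s: "s = (i, v, e)" by (rule prod_cases3)
  have *: "vec_cong (2 ^ n) (v v* mat_pow Z l) v" if "[l = 0] (mod 4)" for l
    using mat_cong_imp_vec_cong[OF Z_pow_cong[OF that], of v] by simp
  have "vec_cong (2 ^ n) (v v* mat_pow Z (k * 4) - u v* mat_geom 4 (mat_pow Z k)) (v - 0)"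
    by (intro vec_cong_diff * geom_4) (simp add: cong_def)
  moreover have "vec_cong (2 ^ n) (v v* mat_pow Z 4) v"
    by (rule *) (simp add: cong_def)
  ultimately show ?thesis
    by (cases e) (simp_all only: s turn_pow_True turn_pow_False, simp_all add: state_cong_def cong_def)
qed

text \<open>The relations \<open>a\<^sup>z = a\<^sup>\<alpha> b\<^sup>\<beta>\<close> and \<open>b\<^sup>z = a\<^sup>\<gamma> b\<^sup>\<delta>\<close> for the action. On states with \<open>e\<close> true this is where
  \<open>J Z\<^sup>k = Z J\<close> is needed.\<close>

lemma turn_shift: "state_cong (turn (shift x s)) (shift (x v* Z) (turn s))"
proof -
  obtain i v e where s: "s = (i, v, e)" by (rule prod_cases3)
  have "vec_cong (2 ^ n) (x v* (swap ** mat_pow Z k)) (x v* (Z ** swap))"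
    by (rule mat_cong_imp_vec_cong) (rule swap_Z_pow_k)
  then have "vec_cong (2 ^ n) (v v* mat_pow Z k - u + x v* (swap ** mat_pow Z k))
      (v v* mat_pow Z k - u + x v* (Z ** swap))"
    by (rule vec_cong_add[OF vec_cong_refl])
  then show ?thesis
    by (cases e) (simp_all add: s turn_def shift_def state_cong_def vector_matrix_left_distrib
        vector_matrix_mul_assoc add_diff_eq diff_add_eq)
qed

lemma Z_pow_swap: "mat_cong (2 ^ n) (mat_pow Z i ** swap) (swap ** mat_pow Z (k * i))"
proof (induction i)
  case (Suc i)
  have "mat_pow Z (Suc i) ** swap = mat_pow Z i ** (Z ** swap)"
    by (simp add: matrix_mul_assoc)
  also have "mat_cong (2 ^ n) \<dots> (mat_pow Z i ** (swap ** mat_pow Z k))"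
    by (rule mat_cong_mult[OF mat_cong_refl mat_cong_sym[OF swap_Z_pow_k]])
  also have "\<dots> = (mat_pow Z i ** swap) ** mat_pow Z k"
    by (simp add: matrix_mul_assoc)
  also have "mat_cong (2 ^ n) \<dots> ((swap ** mat_pow Z (k * i)) ** mat_pow Z k)"
    by (rule mat_cong_mult[OF Suc mat_cong_refl])
  also have "\<dots> = swap ** mat_pow Z (k * Suc i)"
    by (simp add: mat_pow_add[symmetric] add.commute flip: matrix_mul_assoc)
  finally show ?case .
qed simp

lemma geom_1_mod_4:
  assumes "[i = 1] (mod 4)"
  shows "vec_cong (2 ^ n) (u v* mat_geom i (mat_pow Z k)) u"
proof -
  have "vec_cong (2 ^ n) (u v* mat_geom (1 + 4 * q) (mat_pow Z k)) u" for q
  proof (induction q)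
    case 0
    then show ?case by (simp add: mat_geom_def)
  next
    case (Suc q)
    let ?X = "mat_pow Z k" and ?i = "1 + 4 * q"
    have "vec_cong (2 ^ n) (u v* mat_geom ?i ?X + u v* mat_geom 4 ?X v* mat_pow ?X ?i)
        (u + 0 v* mat_pow ?X ?i)"
      by (intro vec_cong_add vec_cong_vector_matrix_mult Suc geom_4)
    moreover have "u v* mat_geom (1 + 4 * Suc q) ?X
        = u v* mat_geom ?i ?X + u v* mat_geom 4 ?X v* mat_pow ?X ?i"
    proof -
      have "1 + 4 * Suc q = ?i + 4" by simp
      then show ?thesis by (simp only: mat_geom_add)
    qed
    ultimately show ?case
      by (simp only: vector_matrix_mult_0 add_0_right)
  qed
  moreover have "i = 1 + 4 * (i div 4)"
    using assms by (simp add: cong_def) presburger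
  ultimately show ?thesis by metis
qed

text \<open>One has \<open>w J = u Z\<^sup>d J = u J X\<^sup>d\<close> with \<open>X = Z\<^sup>k\<close>. By the third condition this is minus the image of
  \<open>u\<close> under the terms \<open>d, \<dots>, d + k - 1\<close> of the geometric sum in \<open>X\<close>. Together with the first \<open>d\<close>
  terms these make up \<open>d + k = 1\<close> modulo 4 terms, and by the fourth condition only the term \<open>u\<close> is
  left.\<close>

lemma translation_after_turns:
  "vec_cong (2 ^ n) (w v* swap - u v* mat_geom d (mat_pow Z k)) (- u)"
proof -
  let ?X = "mat_pow Z k"
  have "vec_cong (2 ^ n) (w v* swap) (u v* mat_pow Z d v* swap)"
    by (rule vec_cong_vector_matrix_mult[OF vec_cong_sym[OF u]])
  also have "vec_cong (2 ^ n) (u v* mat_pow Z d v* swap) (u v* swap v* mat_pow Z (k * d))"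
    using mat_cong_imp_vec_cong[OF Z_pow_swap] by (simp add: vector_matrix_mul_assoc)
  also have "vec_cong (2 ^ n) (u v* swap v* mat_pow Z (k * d))
      (- (u v* mat_geom k ?X) v* mat_pow Z (k * d))"
  proof (rule vec_cong_vector_matrix_mult)
    have "vec_cong (2 ^ n) (u v* swap - - (u v* mat_geom k ?X)) 0"
      using geom_k by (simp add: vector_matrix_mult_add_rdistrib add.commute)
    then show "vec_cong (2 ^ n) (u v* swap) (- (u v* mat_geom k ?X))"
      by (simp only: vec_cong_diff_0)
  qed
  finally have "vec_cong (2 ^ n) (w v* swap - u v* mat_geom d ?X)
      (- (u v* mat_geom k ?X) v* mat_pow Z (k * d) - u v* mat_geom d ?X)"
    by (rule vec_cong_diff[OF _ vec_cong_refl])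
  also have "\<dots> = - (u v* mat_geom (d + k) ?X)"
    by (simp add: mat_geom_add vector_matrix_mult_minus mat_pow_mult)
  also have "vec_cong (2 ^ n) \<dots> (- u)"
    using k_d by (intro vec_cong_minus geom_1_mod_4) (simp add: add.commute)
  finally show ?thesis .
qed

text \<open>The relation \<open>t z = z t z\<^sup>d \<phi>(w)\<close> for the action. For \<open>e\<close> true it reduces to \<open>u Z\<^sup>d = w\<close> and
  \<open>k + d = 1\<close> modulo 4; for \<open>e\<close> false the translation part is computed in the previous lemma.\<close>

lemma turn_flip: "state_cong (turn (flip s)) (shift w ((turn ^^ d) (flip (turn s))))"
proof -
  obtain i v e where s: "s = (i, v, e)" by (rule prod_cases3)
  show ?thesis
  proof (cases e)
    case False
    obtain d' where d': "d = 2 * d'" using even_d by (elim evenE)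
    obtain k' where k': "k = 2 * k' + 1" using odd_k by (elim oddE)
    have "k + d = 2 * (k' + d') + 1" by (simp add: d' k')
    with k_d have "(2 * (k' + d') + 1) mod 4 = 1" by (simp add: cong_def)
    \<comment> \<open>As \<open>d\<close> is even, \<open>k d = d\<close> and \<open>2 d = 0\<close> modulo 4, hence \<open>1 + k d = 1 - d = k\<close>.\<close>
    moreover have odd_mod_4: "(2 * x + 1) mod 4 = (if even x then 1 else 3)" for x :: nat
      by presburger
    ultimately have "even k' \<longleftrightarrow> even d'"
      by (metis even_add numeral_eq_one_iff semiring_norm(86))
    then have "(1 + 2 * d') mod 4 = (2 * k' + 1) mod 4"
      using odd_mod_4[of k'] odd_mod_4[of d'] by (simp only: add.commute[of 1])
    moreover have "1 + k * d = (1 + 2 * d') + (k' * d') * 4"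
      by (simp add: d' k' algebra_simps)
    ultimately have "[1 + k * d = k] (mod 4)"
      by (simp only: cong_def mod_mult_self1 k')
    then have "vec_cong (2 ^ n) (v v* mat_pow Z k) (v v* mat_pow Z (1 + k * d))"
      by (intro mat_cong_imp_vec_cong Z_pow_cong) (rule cong_sym)
    then have "vec_cong (2 ^ n) (v v* mat_pow Z k + - u)
        (v v* mat_pow Z (1 + k * d) + (w v* swap - u v* mat_geom d (mat_pow Z k)))"
      by (intro vec_cong_add vec_cong_sym[OF translation_after_turns])
    moreover have "[i + k = i + 1 + k * d] (mod 4)"
      using cong_add[OF cong_refl cong_sym[OF \<open>[1 + k * d = k] (mod 4)\<close>], of i]
      by (simp add: add.assoc)
    moreover have "mat_pow Z (1 + k * d) = Z ** mat_pow Z (k * d)"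
      unfolding mat_pow_add by simp
    ultimately show ?thesis
      using False by (simp add: s turn_simps flip_def shift_def state_cong_def turn_pow_True
          vector_matrix_mul_assoc add_diff_eq diff_add_eq)
  next
    case True
    have "vec_cong (2 ^ n) (v v* mat_pow Z 1) (v v* mat_pow Z (k + d))"
      by (intro mat_cong_imp_vec_cong Z_pow_cong cong_sym[OF k_d])
    then have "vec_cong (2 ^ n) (v v* mat_pow Z 1 - w + w) (v v* mat_pow Z (k + d) - u v* mat_pow Z d + w)"
      by (intro vec_cong_add vec_cong_diff vec_cong_sym[OF u] vec_cong_refl)
    moreover have "[i + 1 = i + k + d] (mod 4)"
      using cong_add[OF cong_refl cong_sym[OF k_d], of i] by (simp add: add.assoc)
    ultimately show ?thesis
      using True by (simp add: s turn_simps flip_def shift_def state_cong_def turn_pow_False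
          vector_matrix_mult_diff_distrib vector_matrix_mul_assoc mat_pow_add)
  qed
qed

lemma word_run_ext_rels:
  assumes rel: "(p, q) \<in> ext_rels n \<alpha> \<beta> \<gamma> \<delta> r s c"
    and Z: "Z = mat2 \<alpha> \<beta> \<gamma> \<delta>" and w: "w = vector [r, s]" and d: "d = nat (2 * c)"
    and nonneg: "\<alpha> \<ge> 0" "\<beta> \<ge> 0" "\<gamma> \<ge> 0" "\<delta> \<ge> 0" "r \<ge> 0" "s \<ge> 0"
  shows "state_cong (word_run letter_act p st) (word_run letter_act q st)"
proof -
  have letter: "word_run letter_act (gletter x) = letter_act (x, True)" for x
    by (simp add: word_run_def gletter_def fun_eq_iff)
  have conj: "word_run letter_act (gconj (gletter x) (gletter y)) st
      = letter_act (y, True) (letter_act (x, True) (letter_act (y, False) st))" for x y st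
    by (simp add: word_run_def gconj_def gletter_def ginv_def)
  have base_word: "word_run letter_act (gpow (gletter Ga) i @ gpow (gletter Gb) j) st
      = shift (vector [int i, int j]) st" for i j st
  proof -
    have "int i *s vector [1, 0] + int j *s vector [0, 1] = (vector [int i, int j] :: int^2)"
      by (simp add: vec_eq_iff forall_2)
    then show ?thesis
      by (simp add: word_run_append word_run_gpow letter shift_pow shift_shift)
  qed
  have z_inv: "state_cong (turn ((turn ^^ 3) st)) st" for st
    using turn_pow_4[of st] by (simp add: numeral_eq_Suc)
  have conj_z: "state_cong (turn (shift x ((turn ^^ 3) st))) (shift (x v* Z) st)" for x st
    using turn_shift[of x "(turn ^^ 3) st"] shift_cong[OF vec_cong_refl z_inv[of st], of "x v* Z"]
    by (rule state_cong_trans)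
  have conj_t_z: "state_cong (turn (flip ((turn ^^ 3) st))) (shift w ((turn ^^ d) (flip st)))"
    using turn_flip[of "(turn ^^ 3) st"]
      shift_cong[OF vec_cong_refl turn_pow_cong[OF flip_cong[OF z_inv[of st]]], of w d]
    by (rule state_cong_trans)
  have shift_N: "state_cong (shift (2 ^ n *s x) st) st" for x
  proof -
    have "vec_cong (2 ^ n) (2 ^ n *s x) 0"
      by (simp add: vec_cong_def cong_def)
    then have "state_cong (shift (2 ^ n *s x) st) (shift 0 st)"
      by (rule shift_cong[OF _ state_cong_refl])
    then show ?thesis using shift_pow[of 0 0] by simp
  qed
  have rows: "vector [1, 0] v* Z = vector [\<alpha>, \<beta>]" "vector [0, 1] v* Z = vector [\<gamma>, \<delta>]"
    "vector [1, 0] v* swap = vector [0, 1]" "vector [0, 1] v* swap = vector [1, 0]"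
    by (simp_all add: Z mat2_def vec_eq_iff forall_2 vector_matrix_mult_def sum_2)
  have comm: "word_run letter_act (gcomm (gletter Ga) (gletter Gb)) st = st"
  proof -
    have "word_run letter_act (gcomm (gletter Ga) (gletter Gb)) st = shift 0 st"
      by (simp add: word_run_def gcomm_def gletter_def ginv_def shift_shift)
    then show ?thesis using shift_pow[of 0 0] by simp
  qed
  show ?thesis
    using rel unfolding ext_rels_def Let_def insert_iff empty_iff prod.inject
    by (elim disjE conjE FalseE)
      (use shift_N nonneg turn_pow_4[of st] conj_z[of "vector [1, 0]" st]
        conj_z[of "vector [0, 1]" st] conj_t_z in
      \<open>simp_all add: word_run_gpow word_run_Nil letter shift_pow flip_flip numeral_2_eq_2 conj comm
        flip_shift rows base_word word_run_append[of _ "gletter Gt"]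
        word_run_append[of _ "gpow (gletter Gz) (nat (2 * c))"] w d\<close>)
qed

end

section \<open>The two presentations\<close>

lemma (in group) conj_eq_iff:
  assumes "x \<in> carrier G" "g \<in> carrier G" "y \<in> carrier G"
  shows "inv g \<otimes> x \<otimes> g = y \<longleftrightarrow> x \<otimes> g = g \<otimes> y"
  using assms by (metis inv_closed inv_solve_left m_assoc m_closed)

lemma (in group) comm_eq_one_iff:
  assumes "x \<in> carrier G" "y \<in> carrier G"
  shows "inv x \<otimes> inv y \<otimes> x \<otimes> y = \<one> \<longleftrightarrow> x \<otimes> y = y \<otimes> x"
proof -
  have "inv x \<otimes> inv y \<otimes> x \<otimes> y = inv (y \<otimes> x) \<otimes> (x \<otimes> y)"
    using assms by (simp add: inv_mult_group m_assoc)
  then show ?thesis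
    using assms by (metis inv_closed inv_equality inv_inv l_inv m_closed)
qed

definition wreath_rels :: "nat \<Rightarrow> (wreath_gen gword \<times> wreath_gen gword) set" where
  "wreath_rels n =
    {(gpow (gletter Wa) (2 ^ n), []), (gpow (gletter Wb) (2 ^ n), []), (gpow (gletter Wt) 2, []),
     (gcomm (gletter Wa) (gletter Wb), []),
     (gconj (gletter Wa) (gletter Wt), gletter Wb), (gconj (gletter Wb) (gletter Wt), gletter Wa)}"

lemma wreathed_eq: "wreathed n = presented_group (wreath_rels n)"
  by (simp add: wreathed_def wreath_rels_def Let_def)

lemma UNIV_wreath_gen: "UNIV = {Wa, Wb, Wt}"
  by (auto intro: wreath_gen.exhaust)

lemma UNIV_ext_gen: "UNIV = {Ga, Gb, Gt, Gz}"
  by (auto intro: ext_gen.exhaust)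

lemma wreath_relations_iff:
  fixes G (structure)
  assumes "group G" and f: "\<And>x. f x \<in> carrier G"
  shows "wreath_relations G n (f Wa) (f Wb) (f Wt)
    \<longleftrightarrow> (\<forall>(p, q) \<in> wreath_rels n. word_val G f p = word_val G f q)"
proof -
  interpret group G by fact
  have "f x [^] (2::nat) = f x \<otimes> f x" for x
    by (simp add: numeral_2_eq_2 f)
  then show ?thesis
    unfolding wreath_relations_def wreath_relations_axioms_def
    by (auto simp: assms wreath_rels_def word_val_simps[OF f] conj_eq_iff comm_eq_one_iff)
qed

lemma wreath_relations_wreathed:
  "wreath_relations (wreathed n) n
     (pres_gen (wreath_rels n) Wa) (pres_gen (wreath_rels n) Wb) (pres_gen (wreath_rels n) Wt)"
  unfolding wreathed_eq
  by (subst wreath_relations_iff)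
    (auto simp: group_presented_group pres_gen_in_carrier intro!: presented_group_relator)

lemma finite_wreathed: "finite (carrier (wreathed n))"
  and card_wreathed_le: "card (carrier (wreathed n)) \<le> 2 * (2 ^ n) ^ 2"
proof -
  let ?g = "pres_gen (wreath_rels n)"
  interpret wreath_relations "wreathed n" n "?g Wa" "?g Wb" "?g Wt"
    by (rule wreath_relations_wreathed)
  have "range ?g = {?g Wa, ?g Wb, ?g Wt}"
    by (simp add: UNIV_wreath_gen)
  then have "carrier (wreathed n) = generate (wreathed n) {?g Wa, ?g Wb, ?g Wt}"
    using carrier_presented_group[of "wreath_rels n"] by (simp add: wreathed_eq)
  then show "finite (carrier (wreathed n))" "card (carrier (wreathed n)) \<le> 2 * (2 ^ n) ^ 2"
    using finite_generate_wreath card_generate_wreath_le by simp_all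
qed

context wreath_relations
begin

lemma wreathed_epimorphism:
  obtains h where "h \<in> hom (wreathed n) G" "h ` carrier (wreathed n) = generate G {a, b, t}"
proof -
  define f where "f = case_wreath_gen a b t"
  have f: "f x \<in> carrier G" for x
    by (cases x) (simp_all add: f_def)
  have "wreath_relations G n (f Wa) (f Wb) (f Wt)"
    using wreath_relations_axioms by (simp add: f_def)
  then have "\<forall>(p, q) \<in> wreath_rels n. word_val G f p = word_val G f q"
    using wreath_relations_iff[OF is_group, where f = f] f by blast
  then have "word_val G f p = word_val G f q" if "(p, q) \<in> wreath_rels n" for p q
    using that by blast
  then obtain h where h: "h \<in> hom (wreathed n) G"
    and val: "\<And>x. h (pres_class (wreath_rels n) x) = word_val G f x"
    unfolding wreathed_eq by (rule presented_group_hom[where f = f and R = "wreath_rels n", OF f]) blast+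
  interpret h: group_hom "wreathed n" G h
    by (rule group_hom.intro[OF _ is_group group_hom_axioms.intro[OF h]])
      (simp add: wreathed_eq group_presented_group)
  have "h (pres_gen (wreath_rels n) x) = f x" for x
    by (simp add: pres_gen_def val word_val_gletter[OF f])
  then have "h ` range (pres_gen (wreath_rels n)) = range f"
    by (auto simp: image_image)
  also have "range f = {a, b, t}"
    by (simp add: f_def UNIV_wreath_gen)
  finally have gens: "h ` range (pres_gen (wreath_rels n)) = {a, b, t}" .
  have "range (pres_gen (wreath_rels n)) \<subseteq> carrier (wreathed n)"
    by (auto simp: wreathed_eq pres_gen_in_carrier)
  then have "generate G {a, b, t} = h ` generate (wreathed n) (range (pres_gen (wreath_rels n)))"
    unfolding gens[symmetric] by (rule h.generate_img)
  then have "h ` carrier (wreathed n) = generate G {a, b, t}"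
    unfolding wreathed_eq carrier_presented_group by (rule HOL.sym)
  with h show thesis by (rule that)
qed

lemma faithful_imp_card_wreathed:
  assumes faithful
  shows "card (carrier (wreathed n)) = 2 * (2 ^ n) ^ 2"
proof -
  obtain h where "h ` carrier (wreathed n) = generate G {a, b, t}"
    by (rule wreathed_epimorphism)
  then have "card (generate G {a, b, t}) \<le> card (carrier (wreathed n))"
    using card_image_le[OF finite_wreathed] by metis
  then show ?thesis
    using assms card_wreathed_le[of n] by (simp add: faithful_iff_card)
qed

text \<open>By the previous lemma the epimorphism is between finite sets of the same size, hence injective.\<close>

lemma faithful_imp_iso_wreathed:
  assumes faithful
  shows "G\<lparr>carrier := generate G {a, b, t}\<rparr> \<cong> wreathed n"
proof -
  obtain h where h: "h \<in> hom (wreathed n) G"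
    and img: "h ` carrier (wreathed n) = generate G {a, b, t}"
    by (rule wreathed_epimorphism)
  have "inj_on h (carrier (wreathed n))"
    using assms faithful_imp_card_wreathed[OF assms] img
    by (intro eq_card_imp_inj_on finite_wreathed) (simp add: faithful_iff_card)
  with h img have "h \<in> iso (wreathed n) (G\<lparr>carrier := generate G {a, b, t}\<rparr>)"
    by (auto simp: iso_def bij_betw_def hom_def)
  then show ?thesis
    using group.iso_sym[OF _ is_isoI] group_presented_group wreathed_eq by metis
qed

end

lemma extension_group_presented:
  fixes n :: nat and \<alpha> \<beta> \<gamma> \<delta> r s c :: int
  defines "R \<equiv> ext_rels n \<alpha> \<beta> \<gamma> \<delta> r s c"
  assumes nonneg: "\<alpha> \<ge> 0" "\<beta> \<ge> 0" "\<gamma> \<ge> 0" "\<delta> \<ge> 0" "r \<ge> 0" "s \<ge> 0"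
    and params: "extension_parameters n (mat2 \<alpha> \<beta> \<gamma> \<delta>) u (vector [r, s]) (nat (2 * c)) k"
  shows "extension_group (presented_group R) n (pres_gen R Ga) (pres_gen R Gb) (pres_gen R Gt)
    (mat2 \<alpha> \<beta> \<gamma> \<delta>) u (vector [r, s]) (nat (2 * c)) k (pres_gen R Gz)"
proof -
  let ?G = "presented_group R"
  define f where "f = pres_gen R"
  interpret group ?G by (rule group_presented_group)
  have f: "f x \<in> carrier ?G" for x
    by (simp add: f_def pres_gen_in_carrier)
  note [simp] = f
  have rel: "\<forall>(p, q) \<in> ext_rels n \<alpha> \<beta> \<gamma> \<delta> r s c. word_val ?G f p = word_val ?G f q"
    unfolding f_def R_def using presented_group_relator by blast
  have sq: "f x [^]\<^bsub>?G\<^esub> (2::nat) = f x \<otimes>\<^bsub>?G\<^esub> f x" for x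
    by (simp add: numeral_2_eq_2)
  have rels: "f Ga [^]\<^bsub>?G\<^esub> (2 ^ n :: nat) = \<one>\<^bsub>?G\<^esub>" "f Gb [^]\<^bsub>?G\<^esub> (2 ^ n :: nat) = \<one>\<^bsub>?G\<^esub>"
    "f Gt \<otimes>\<^bsub>?G\<^esub> f Gt = \<one>\<^bsub>?G\<^esub>" "f Gz [^]\<^bsub>?G\<^esub> (4::nat) = \<one>\<^bsub>?G\<^esub>"
    "f Ga \<otimes>\<^bsub>?G\<^esub> f Gb = f Gb \<otimes>\<^bsub>?G\<^esub> f Ga"
    "f Ga \<otimes>\<^bsub>?G\<^esub> f Gt = f Gt \<otimes>\<^bsub>?G\<^esub> f Gb" "f Gb \<otimes>\<^bsub>?G\<^esub> f Gt = f Gt \<otimes>\<^bsub>?G\<^esub> f Ga"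
    "f Ga \<otimes>\<^bsub>?G\<^esub> f Gz = f Gz \<otimes>\<^bsub>?G\<^esub> (f Ga [^]\<^bsub>?G\<^esub> nat \<alpha> \<otimes>\<^bsub>?G\<^esub> f Gb [^]\<^bsub>?G\<^esub> nat \<beta>)"
    "f Gb \<otimes>\<^bsub>?G\<^esub> f Gz = f Gz \<otimes>\<^bsub>?G\<^esub> (f Ga [^]\<^bsub>?G\<^esub> nat \<gamma> \<otimes>\<^bsub>?G\<^esub> f Gb [^]\<^bsub>?G\<^esub> nat \<delta>)"
    "f Gt \<otimes>\<^bsub>?G\<^esub> f Gz = f Gz \<otimes>\<^bsub>?G\<^esub> (f Gt \<otimes>\<^bsub>?G\<^esub> (f Gz [^]\<^bsub>?G\<^esub> nat (2 * c) \<otimes>\<^bsub>?G\<^esub>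
       (f Ga [^]\<^bsub>?G\<^esub> nat r \<otimes>\<^bsub>?G\<^esub> f Gb [^]\<^bsub>?G\<^esub> nat s)))"
    using rel unfolding ext_rels_def Let_def
    by (simp_all only: ball_simps prod.case word_val_simps[OF f] conj_eq_iff comm_eq_one_iff sq
        f m_closed nat_pow_closed simp_thms)
  interpret wreath_relations ?G n "f Ga" "f Gb" "f Gt"
    by unfold_locales (simp_all add: rels)
  interpret extension_parameters n "mat2 \<alpha> \<beta> \<gamma> \<delta>" u "vector [r, s]" "nat (2 * c)" k
    by (rule params)
  have base: "base (vector [i, j]) = f Ga [^]\<^bsub>?G\<^esub> nat i \<otimes>\<^bsub>?G\<^esub> f Gb [^]\<^bsub>?G\<^esub> nat j"
    if "i \<ge> 0" "j \<ge> 0" for i j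
    using that by (simp add: base_def)
  have range_f: "range f = {f Ga, f Gb, f Gt, f Gz}"
    by (simp add: UNIV_ext_gen)
  have "extension_group ?G n (f Ga) (f Gb) (f Gt) (mat2 \<alpha> \<beta> \<gamma> \<delta>) u (vector [r, s]) (nat (2 * c)) k (f Gz)"
  proof unfold_locales
    show "f Gz \<in> carrier ?G" by simp
    show "f Gz [^]\<^bsub>?G\<^esub> (4::nat) = \<one>\<^bsub>?G\<^esub>" by (rule rels)
    show "f Ga \<otimes>\<^bsub>?G\<^esub> f Gz = f Gz \<otimes>\<^bsub>?G\<^esub> base (mat2 \<alpha> \<beta> \<gamma> \<delta> $ 1)"
      using rels(8) nonneg by (simp add: mat2_def base del: pow_nat)
    show "f Gb \<otimes>\<^bsub>?G\<^esub> f Gz = f Gz \<otimes>\<^bsub>?G\<^esub> base (mat2 \<alpha> \<beta> \<gamma> \<delta> $ 2)"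
      using rels(9) nonneg by (simp add: mat2_def base del: pow_nat)
    show "f Gt \<otimes>\<^bsub>?G\<^esub> f Gz = f Gz \<otimes>\<^bsub>?G\<^esub> f Gt \<otimes>\<^bsub>?G\<^esub> f Gz [^]\<^bsub>?G\<^esub> nat (2 * c) \<otimes>\<^bsub>?G\<^esub> base (vector [r, s])"
      using rels(10) nonneg by (simp add: base m_assoc del: pow_nat)
    show "carrier ?G = generate ?G {f Ga, f Gb, f Gt, f Gz}"
      using carrier_presented_group[of R] range_f by (simp only: f_def)
  qed
  then show ?thesis by (simp add: f_def)
qed

text \<open>Apply the action to a word that represents \<open>z\<^sup>i base v t\<^sup>e\<close>, starting from the state \<open>(0, 0, False)\<close>
  of the neutral element. The vector is reduced modulo \<open>N\<close> first, because words have natural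
  exponents.\<close>

lemma faithful_normal_forms_presented:
  fixes n :: nat and \<alpha> \<beta> \<gamma> \<delta> r s c :: int
  defines "R \<equiv> ext_rels n \<alpha> \<beta> \<gamma> \<delta> r s c"
  assumes nonneg: "\<alpha> \<ge> 0" "\<beta> \<ge> 0" "\<gamma> \<ge> 0" "\<delta> \<ge> 0" "r \<ge> 0" "s \<ge> 0"
    and params: "compatible_parameters n (mat2 \<alpha> \<beta> \<gamma> \<delta>) u (vector [r, s]) (nat (2 * c)) k"
  shows "extension_group.faithful_normal_forms (presented_group R) n
    (pres_gen R Ga) (pres_gen R Gb) (pres_gen R Gt) (pres_gen R Gz)"
proof -
  let ?G = "presented_group R" and ?f = "pres_gen R"
  interpret compatible_parameters n "mat2 \<alpha> \<beta> \<gamma> \<delta>" u "vector [r, s]" "nat (2 * c)" k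
    by (rule params)
  interpret extension_group ?G n "?f Ga" "?f Gb" "?f Gt" "mat2 \<alpha> \<beta> \<gamma> \<delta>" u "vector [r, s]"
    "nat (2 * c)" k "?f Gz"
    unfolding R_def by (rule extension_group_presented[OF nonneg extension_parameters_axioms])
  show ?thesis
    unfolding faithful_normal_forms_def
  proof (intro allI impI)
    fix i e :: nat and v :: "int^2"
    assume eq: "?f Gz [^]\<^bsub>?G\<^esub> i \<otimes>\<^bsub>?G\<^esub> base v \<otimes>\<^bsub>?G\<^esub> ?f Gt [^]\<^bsub>?G\<^esub> e = \<one>\<^bsub>?G\<^esub>"
    let ?v = "vector [v $ 1 mod 2 ^ n, v $ 2 mod 2 ^ n] :: int^2"
    have v: "vec_cong (2 ^ n) v ?v"
      by (simp add: vec_cong_def forall_2)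
    define p where "p = gpow (gletter Gz) i @ gpow (gletter Ga) (nat (v $ 1 mod 2 ^ n))
        @ gpow (gletter Gb) (nat (v $ 2 mod 2 ^ n)) @ gpow (gletter Gt) e"
    have "pres_class R p = word_val ?G ?f p"
      by (simp add: word_val_pres_gen)
    also have "\<dots> = ?f Gz [^]\<^bsub>?G\<^esub> i \<otimes>\<^bsub>?G\<^esub> base ?v \<otimes>\<^bsub>?G\<^esub> ?f Gt [^]\<^bsub>?G\<^esub> e"
      by (simp add: p_def word_val_simps[OF pres_gen_in_carrier] pres_gen_in_carrier base_def m_assoc)
    also have "\<dots> = pres_class R []"
      using eq base_cong[OF v] by (simp add: one_presented_group)
    finally have "pres_eq R p []"
      by (simp add: pres_class_eq_iff)
    then have "state_cong (word_run letter_act p (0, 0, False)) (word_run letter_act [] (0, 0, False))"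
    proof (rule pres_eq_word_run[OF _ equivp_state_cong letter_act_cong])
      show "state_cong (word_run letter_act p' s') (word_run letter_act q' s')"
        if "(p', q') \<in> R" for p' q' s'
        by (rule word_run_ext_rels[OF that[unfolded R_def] HOL.refl HOL.refl HOL.refl nonneg])
      show "state_cong (letter_act (x, \<not> e) (letter_act (x, e) s')) s'" for x e s'
        using turn_pow_4[of s'] shift_pow[of 0 0]
        by (cases x) (simp_all add: shift_shift flip_flip numeral_eq_Suc)
    qed
    moreover have "word_run letter_act p (0, 0, False) = (i, ?v, odd e)"
    proof -
      have letter: "word_run letter_act (gletter x) = letter_act (x, True)" for x
        by (simp add: word_run_def gletter_def fun_eq_iff)
      have "(flip ^^ e) (i, v, False) = (i, v, odd e)" for v
        by (induction e) (simp_all add: flip_def)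
      then show ?thesis
        by (simp add: p_def word_run_append word_run_gpow letter shift_pow turn_pow_False)
          (simp add: shift_def vec_eq_iff forall_2)
    qed
    ultimately have "[i = 0] (mod 4)" "vec_cong (2 ^ n) ?v 0" "even e"
      by (simp_all add: state_cong_def word_run_Nil)
    then show "4 dvd i \<and> vec_cong (2 ^ n) v 0 \<and> even e"
      using vec_cong_trans[OF v] by (simp add: cong_0_iff)
  qed
qed

text \<open>For \<open>Z = I\<close> and \<open>r = s = c = 0\<close> all conditions hold, so the extension has a subgroup of
  order \<open>2N\<^sup>2\<close> that satisfies the wreathed relations. Being an image of the wreathed group, it gives
  the lower bound; normal forms give the upper bound.\<close>

lemma card_wreathed: "card (carrier (wreathed n)) = 2 * (2 ^ n) ^ 2"
proof -
  have id: "mat2 1 0 0 1 = mat 1"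
    by (simp add: mat2_def mat_def vec_eq_iff forall_2)
  have pow: "mat_pow (mat 1) l = (mat 1 :: int^2^2)" for l
    by (induction l) simp_all
  have params: "compatible_parameters n (mat2 1 0 0 1) 0 (vector [0, 0]) (nat (2 * 0)) 1"
  proof -
    interpret extension_parameters n "mat2 1 0 0 1" 0 "vector [0, 0]" "nat (2 * 0)" 1
      by unfold_locales (simp_all add: vec_cong_def forall_2)
    show ?thesis
      by unfold_locales
        (unfold compatible_def, unfold id pow, simp add: swap_mult_swap)
  qed
  let ?R = "ext_rels n 1 0 0 1 0 0 0"
  interpret compatible_parameters n "mat2 1 0 0 1" 0 "vector [0, 0]" "nat (2 * 0)" 1
    by (rule params)
  interpret extension_group "presented_group ?R" n "pres_gen ?R Ga" "pres_gen ?R Gb" "pres_gen ?R Gt"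
    "mat2 1 0 0 1" 0 "vector [0, 0]" "nat (2 * 0)" 1 "pres_gen ?R Gz"
    by (rule extension_group_presented[OF _ _ _ _ _ _ extension_parameters_axioms]) simp_all
  have faithful_normal_forms
    by (rule faithful_normal_forms_presented[OF _ _ _ _ _ _ params]) simp_all
  then show ?thesis
    by (intro faithful_imp_card_wreathed faithful_normal_forms_imp_faithful)
qed

lemma (in wreath_relations) iso_wreathed_iff_faithful:
  "G\<lparr>carrier := generate G {a, b, t}\<rparr> \<cong> wreathed n \<longleftrightarrow> faithful"
  using faithful_imp_iso_wreathed iso_same_card[of "G\<lparr>carrier := generate G {a, b, t}\<rparr>" "wreathed n"]
  by (auto simp: card_wreathed faithful_iff_card)

section \<open>The criterion\<close>

theorem theorem6p1:
  fixes n :: nat and \<alpha> \<beta> \<gamma> \<delta> r s c :: int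
  defines "N \<equiv> (2::int) ^ n"
  defines "Z \<equiv> mat2 \<alpha> \<beta> \<gamma> \<delta>" and "J \<equiv> mat2 0 1 1 0"
  defines "R \<equiv> ext_rels n \<alpha> \<beta> \<gamma> \<delta> r s c"
  defines "G \<equiv> presented_group R"
  defines "a \<equiv> pres_gen R Ga" and "b \<equiv> pres_gen R Gb"
    and "t \<equiv> pres_gen R Gt" and "z \<equiv> pres_gen R Gz"
  defines "H \<equiv> generate G {a, b, t}" and "K \<equiv> generate G {z}" and "B \<equiv> generate G {a, b}"
  defines "A\<^sub>s \<equiv> seqA (\<alpha> + \<delta>) (\<alpha> * \<delta> - \<beta> * \<gamma>)" and "B\<^sub>s \<equiv> seqB (\<alpha> + \<delta>) (\<alpha> * \<delta> - \<beta> * \<gamma>)"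
  defines "k \<equiv> nat ((1 - 2 * c) mod 4)"
  assumes "n \<ge> 1"
    and "\<alpha> \<in> {0..<N}" "\<beta> \<in> {0..<N}" "\<gamma> \<in> {0..<N}" "\<delta> \<in> {0..<N}"
    and "r \<in> {0..<N}" "s \<in> {0..<N}" "c \<in> {0..<4}"
    and "invertible_mod N Z"
  shows "((exact_product G H K
            \<and> G\<lparr>carrier := H\<rparr> \<cong> wreathed n
            \<and> G\<lparr>carrier := K\<rparr> \<cong> integer_mod_group 4
            \<and> B \<lhd> G)
         \<longleftrightarrow>
         (([A\<^sub>s 4 * \<alpha> + B\<^sub>s 4 = 1] (mod N) \<and> [A\<^sub>s 4 * \<beta> = 0] (mod N)
             \<and> [A\<^sub>s 4 * \<gamma> = 0] (mod N) \<and> [A\<^sub>s 4 * \<delta> + B\<^sub>s 4 = 1] (mod N))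
          \<and> ([A\<^sub>s k * \<alpha> + B\<^sub>s k = \<delta>] (mod N) \<and> [A\<^sub>s k * \<beta> = \<gamma>] (mod N)
             \<and> [A\<^sub>s k * \<gamma> = \<beta>] (mod N) \<and> [A\<^sub>s k * \<delta> + B\<^sub>s k = \<alpha>] (mod N))
          \<and> vec_cong N
              (vector [r, s] v* (mat_powi_mod N Z (- 2 * c) ** (mat_geom k (mat_pow Z k) + J))) 0
          \<and> vec_cong N
              (vector [r, s] v* (mat_powi_mod N Z (- 2 * c) ** mat_geom 4 (mat_pow Z k))) 0))
         \<and> [(1 - 2 * c)\<^sup>2 = 1] (mod 4)"
proof -
  define w :: "int^2" where "w = vector [r, s]"
  define P where "P = mat_powi_mod N Z (- 2 * c)"
  define u where "u = w v* P"
  define d where "d = nat (2 * c)"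
  have nonneg: "\<alpha> \<ge> 0" "\<beta> \<ge> 0" "\<gamma> \<ge> 0" "\<delta> \<ge> 0" "r \<ge> 0" "s \<ge> 0" and c: "0 \<le> c" "c < 4"
    using assms by simp_all
  have k: "int k = (1 - 2 * c) mod 4"
    by (simp add: k_def)
  have P: "mat_cong N (P ** mat_pow Z d) (mat 1)"
  proof (cases "c = 0")
    case True
    then show ?thesis by (simp add: P_def d_def mat_powi_mod_def)
  next
    case False
    have "is_mat_inv_mod N Z (mat_inv_mod N Z)"
      using \<open>invertible_mod N Z\<close> unfolding invertible_mod_def mat_inv_mod_def by (rule someI_ex)
    then have "mat_cong N (mat_pow (mat_inv_mod N Z) d ** mat_pow Z d) (mat 1)"
      by (intro mat_pow_left_inverse) (simp add: is_mat_inv_mod_def)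
    then show ?thesis
      using False c by (simp add: P_def d_def mat_powi_mod_def)
  qed
  have params: "extension_parameters n Z u w d k"
  proof
    show "vec_cong (2 ^ n) (u v* mat_pow Z d) w"
      using mat_cong_imp_vec_cong[OF P, of w] by (simp add: u_def N_def vector_matrix_mul_assoc)
    have "int (k + d) mod 4 = 1 mod 4" 
      using c by (simp add: k d_def mod_simps)
    then show "[k + d = 1] (mod 4)"
      by (simp add: cong_def flip: of_nat_mod) presburger
    show "odd k"
      using k by presburger
  qed
  interpret extension_parameters n Z u w d k by (rule params)
  interpret extension_group G n a b t Z u w d k z
    using extension_group_presented[OF nonneg, of n u c k] params
    unfolding G_def R_def a_def b_def t_def z_def Z_def w_def d_def by blast
  have swap_Z_swap: "swap ** Z ** swap = mat2 \<delta> \<gamma> \<beta> \<alpha>"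
    by (simp add: Z_def mat2_def matrix_matrix_mult_def vec_eq_iff forall_2 sum_2)
  have mat_cong_mat2: "mat_cong N (mat2 x1 x2 x3 x4) (mat2 y1 y2 y3 y4) \<longleftrightarrow>
      [x1 = y1] (mod N) \<and> [x2 = y2] (mod N) \<and> [x3 = y3] (mod N) \<and> [x4 = y4] (mod N)"
    for x1 x2 x3 x4 y1 y2 y3 y4
    by (simp add: mat_cong_def mat2_def forall_2)
  have "mat2 1 0 0 1 = mat 1"
    by (simp add: mat2_def mat_def vec_eq_iff forall_2)
  then have cond1: "mat_cong N (mat_pow Z 4) (mat 1) \<longleftrightarrow>
      [A\<^sub>s 4 * \<alpha> + B\<^sub>s 4 = 1] (mod N) \<and> [A\<^sub>s 4 * \<beta> = 0] (mod N)
      \<and> [A\<^sub>s 4 * \<gamma> = 0] (mod N) \<and> [A\<^sub>s 4 * \<delta> + B\<^sub>s 4 = 1] (mod N)"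
    using mat_cong_mat2[where ?y1.0 = 1 and ?y2.0 = 0 and ?y3.0 = 0 and ?y4.0 = 1]
    unfolding Z_def mat_pow_mat2 A\<^sub>s_def B\<^sub>s_def by metis
  have cond2: "mat_cong N (mat_pow Z k) (swap ** Z ** swap) \<longleftrightarrow>
      [A\<^sub>s k * \<alpha> + B\<^sub>s k = \<delta>] (mod N) \<and> [A\<^sub>s k * \<beta> = \<gamma>] (mod N)
      \<and> [A\<^sub>s k * \<gamma> = \<beta>] (mod N) \<and> [A\<^sub>s k * \<delta> + B\<^sub>s k = \<alpha>] (mod N)"
    unfolding swap_Z_swap unfolding Z_def mat_pow_mat2 A\<^sub>s_def B\<^sub>s_def by (rule mat_cong_mat2)
  have "(exact_product G H K \<and> G\<lparr>carrier := H\<rparr> \<cong> wreathed n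
      \<and> G\<lparr>carrier := K\<rparr> \<cong> integer_mod_group 4 \<and> B \<lhd> G) \<longleftrightarrow> compatible"
  proof
    assume "exact_product G H K \<and> G\<lparr>carrier := H\<rparr> \<cong> wreathed n
      \<and> G\<lparr>carrier := K\<rparr> \<cong> integer_mod_group 4 \<and> B \<lhd> G"
    then have faithful by (simp add: H_def iso_wreathed_iff_faithful)
    then show compatible by (rule faithful_imp_compatible)
  next
    assume compatible
    then have "compatible_parameters n Z u w d k"
      using params by (simp add: compatible_parameters_def compatible_parameters_axioms_def)
    then have "faithful_normal_forms"
      using faithful_normal_forms_presented[OF nonneg, of n u c k]
      unfolding G_def R_def a_def b_def t_def z_def Z_def w_def d_def by blast
    then show "exact_product G H K \<and> G\<lparr>carrier := H\<rparr> \<cong> wreathed n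
      \<and> G\<lparr>carrier := K\<rparr> \<cong> integer_mod_group 4 \<and> B \<lhd> G"
      unfolding H_def K_def B_def
      by (simp add: exact_product_normal_forms iso_wreathed_iff_faithful
          faithful_normal_forms_imp_faithful generate_z_iso base_normal)
  qed
  moreover have "[(1 - 2 * c)\<^sup>2 = 1] (mod 4)"
  proof -
    have "(1 - 2 * c)\<^sup>2 - 1 = 4 * (c * c - c)"
      by (simp add: power2_eq_square algebra_simps)
    then show ?thesis by (metis cong_iff_dvd_diff dvd_triv_left)
  qed
  ultimately show ?thesis
    unfolding compatible_def N_def[symmetric] cond1 cond2
    by (simp add: J_def u_def P_def w_def vector_matrix_mul_assoc)
qed

end
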